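(* Let $n\geqslant 4$ and $k$ be integers for which there exists a connected graph with $n$ vertices and exactly $k$ cut edges. Then, among all connected graphs with $n$ vertices and exactly $k$ cut edges, the minimal distance spectral radius is obtained uniquely at $K_n^k$; that is, every connected graph $G$ with $n$ vertices and $k$ cut edges satisfies $\Lambda_1(G)\geqslant\Lambda_1(K_n^k)$, with equality only when $G\cong K_n^k$.
   Context: All graphs are finite, simple and connected. For a connected graph $H$ with vertex set $\{1,\ldots,n\}$, $\mathrm{dist}(i,j)$ is the number of edges of a shortest path from $i$ to $j$, and the distance matrix $D(H)$ is the $n\times n$ matrix with $(i,j)$-entry $\mathrm{dist}(i,j)$. The distance spectral radius $\Lambda_1(H)$ is the eigenvalue of $D(H)$ of largest magnitude. $K_n^k$ is the $n$-vertex graph obtained by joining $k$ independent (new, pairwise non-adjacent) vertices to one vertex of the complete graph $K_{n-k}$. A cut edge is an edge whose removal disconnects the graph. *)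

theory Defs
  imports
    "Jordan_Normal_Form.Char_Poly"
    "Graph_Theory.Digraph_Component"
    "Graph_Theory.Digraph_Isomorphism"
    "Graph_Theory.Shortest_Path"
begin

text \<open>
  A finite simple graph is a \<open>pair_graph\<close>: finite, loop-free and symmetric, where an undirected
  edge \<open>{u, v}\<close> is represented by the two arcs \<open>(u, v)\<close> and \<open>(v, u)\<close>.  The vertex set is
  \<open>{0..<n}\<close> instead of \<open>{1..n}\<close>, in accordance with the index range of \<^typ>\<open>real mat\<close>.
\<close>

definition connected_graph :: "nat \<Rightarrow> nat pair_pre_digraph \<Rightarrow> bool" where
  "connected_graph n G \<longleftrightarrow>
     pair_graph G \<and> pverts G = {0..<n} \<and> Digraph_Component.connected (with_proj G)"

definition delete_edge :: "'a pair_pre_digraph \<Rightarrow> 'a \<Rightarrow> 'a \<Rightarrow> 'a pair_pre_digraph" where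
  "delete_edge G u v = G\<lparr>parcs := parcs G - {(u, v), (v, u)}\<rparr>"

text \<open>Cut edges are unordered pairs, so that each undirected edge is counted once.\<close>

definition cut_edges :: "'a pair_pre_digraph \<Rightarrow> 'a set set" where
  "cut_edges G = {{u, v} | u v. (u, v) \<in> parcs G \<and>
     \<not> Digraph_Component.connected (with_proj (delete_edge G u v))}"

definition connected_graphs_with_cut_edges :: "nat \<Rightarrow> nat \<Rightarrow> nat pair_pre_digraph set" where
  "connected_graphs_with_cut_edges n k = {G. connected_graph n G \<and> card (cut_edges G) = k}"

text \<open>
  With unit arc weights, \<open>\<mu>\<close> is the least number of arcs of a walk from \<open>u\<close> to \<open>v\<close>;
  it is finite if the graph is connected.
\<close>

definition graph_dist :: "'a pair_pre_digraph \<Rightarrow> 'a \<Rightarrow> 'a \<Rightarrow> real" where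
  "graph_dist G u v = real_of_ereal (wf_digraph.\<mu> (with_proj G) (\<lambda>_. 1) u v)"

definition distance_matrix :: "nat pair_pre_digraph \<Rightarrow> real mat" where
  "distance_matrix G =
     (let n = card (pverts G) in Matrix.mat n n (\<lambda>(i, j). graph_dist G i j))"

text \<open>
  The distance matrix is real symmetric, hence all its eigenvalues are real.  For a connected graph
  on at least three vertices the (signed) eigenvalue of largest absolute value is unique.  On two
  vertices it is not: the eigenvalues are \<open>1\<close> and \<open>-1\<close>.
\<close>

definition distance_spectral_radius :: "nat pair_pre_digraph \<Rightarrow> real" where
  "distance_spectral_radius G =
     (THE l. is_arg_max abs (eigenvalue (distance_matrix G)) l)"

text \<open>
  The graph \<open>K\<^sub>n\<^sup>k\<close> (for \<open>k < n\<close>): the vertices \<open>0, ..., n-k-1\<close> form a clique, and each of the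
  \<open>k\<close> vertices \<open>n-k, ..., n-1\<close> is adjacent exactly to the vertex \<open>0\<close>.
\<close>

definition K_pendant :: "nat \<Rightarrow> nat \<Rightarrow> nat pair_pre_digraph" where
  "K_pendant n k = \<lparr>
     pverts = {0..<n},
     parcs = {(u, v). u < n - k \<and> v < n - k \<and> u \<noteq> v}
           \<union> ({0} \<times> {n - k..<n}) \<union> ({n - k..<n} \<times> {0})\<rparr>"

end

theory Submission
  imports Defs "HOL-Analysis.Function_Topology"
begin

text \<open>
  Let \<open>x\<close> be the Perron vector of \<open>K\<^sub>n\<^sup>k\<close>, with the value \<open>a\<close> at the centre, \<open>b\<close> on the other \<open>m = n - k - 1\<close>
  clique vertices and \<open>c\<close> on the pendant vertices. Given \<open>G\<close> with \<open>k\<close> cut edges, choose a root \<open>r\<close> of degree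
  at least two that lies on a cut edge (if there is one). Each cut edge has exactly one end that it separates from
  \<open>r\<close>, and these \<open>k\<close> far ends are distinct. Give weight \<open>a\<close> to \<open>r\<close>, \<open>c\<close> to the far ends and \<open>b\<close> to the other vertices;
  up to a bijection of the vertices this is again \<open>x\<close>.

  The distance of \<open>s\<close> and \<open>t\<close> in \<open>G\<close> is at least the number of cut edges separating them, plus one if \<open>s\<close> and \<open>t\<close> are
  not connected by cut edges alone. Summed against the weights, a cut edge whose sides have weights \<open>X\<close> and \<open>S - X\<close>
  contributes \<open>X (S - X) \<ge> c (S - c)\<close>, since both sides weigh at least \<open>c\<close>. The vertices that are not far ends are
  pairwise not connected by cut edges, which bounds the remaining part. The two bounds add up to the value of the
  quadratic form for \<open>K\<^sub>n\<^sup>k\<close>, so the Rayleigh quotient at \<open>x\<close> gives the inequality. In the case of equality all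
  far ends are leaves attached to \<open>r\<close>, and the other vertices are pairwise adjacent.
\<close>

section \<open>Nonnegative quadratic forms\<close>

definition quad_form :: "nat \<Rightarrow> (nat \<Rightarrow> nat \<Rightarrow> real) \<Rightarrow> (nat \<Rightarrow> real) \<Rightarrow> real" where
  "quad_form n d x = (\<Sum>i<n. \<Sum>j<n. d i j * x i * x j)"

definition sq_norm_upto :: "nat \<Rightarrow> (nat \<Rightarrow> real) \<Rightarrow> real" where
  "sq_norm_upto n x = (\<Sum>i<n. (x i)\<^sup>2)"

text \<open>Trades library vectors for functions on \<open>nat\<close>, of which only the values
  below \<open>n\<close> matter, so that all later arguments are about finite sums.\<close>

lemma eigenvalue_mat_iff:
  fixes d :: "nat \<Rightarrow> nat \<Rightarrow> real"
  shows "eigenvalue (Matrix.mat n n (\<lambda>(i, j). d i j)) l \<longleftrightarrow>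
    (\<exists>x. (\<exists>i<n. x i \<noteq> 0) \<and> (\<forall>i<n. (\<Sum>j<n. d i j * x j) = l * x i))"
    (is "eigenvalue ?A l \<longleftrightarrow> ?R")
proof
  assume "eigenvalue ?A l"
  then obtain v where v: "v \<in> carrier_vec n" "v \<noteq> 0\<^sub>v n" "?A *\<^sub>v v = l \<cdot>\<^sub>v v"
    unfolding eigenvalue_def eigenvector_def by auto
  have "\<exists>i<n. v $ i \<noteq> 0"
    using v(1,2) by (metis carrier_vecD eq_vecI index_zero_vec(1) index_zero_vec(2))
  moreover have "(\<Sum>j<n. d i j * v $ j) = l * v $ i" if "i < n" for i
    using arg_cong[OF v(3), of "\<lambda>w. w $ i"] that v(1)
    by (simp add: scalar_prod_def lessThan_atLeast0)
  ultimately show ?R by blast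
next
  assume ?R
  then obtain x where x: "\<exists>i<n. x i \<noteq> 0" "\<forall>i<n. (\<Sum>j<n. d i j * x j) = l * x i"
    by blast
  have "eigenvector ?A (vec n x) l"
    unfolding eigenvector_def
  proof (intro conjI)
    show "vec n x \<noteq> 0\<^sub>v (dim_row ?A)"
      using x(1) by (metis dim_row_mat(1) index_vec index_zero_vec(1))
    show "?A *\<^sub>v vec n x = l \<cdot>\<^sub>v vec n x"
      using x(2) by (intro eq_vecI) (auto simp: scalar_prod_def lessThan_atLeast0)
  qed auto
  then show "eigenvalue ?A l"
    unfolding eigenvalue_def by blast
qed

section \<open>Rayleigh quotients and Perron vectors\<close>

lemma quad_form_scale: "quad_form n d (\<lambda>i. t * x i) = t\<^sup>2 * quad_form n d x"
  unfolding quad_form_def by (simp add: sum_distrib_left power2_eq_square algebra_simps)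

lemma sq_norm_upto_eq_0_iff: "sq_norm_upto n x = 0 \<longleftrightarrow> (\<forall>i<n. x i = 0)"
  unfolding sq_norm_upto_def by (subst sum_nonneg_eq_0_iff) auto

lemma sq_norm_upto_nonneg: "sq_norm_upto n x \<ge> 0"
  unfolding sq_norm_upto_def by (simp add: sum_nonneg)

lemma sq_norm_upto_pos: "\<exists>i<n. x i \<noteq> 0 \<Longrightarrow> sq_norm_upto n x > 0"
  using sq_norm_upto_eq_0_iff[of n x] sq_norm_upto_nonneg[of n x] by fastforce

text \<open>Compactness of the unit sphere: the form attains its maximum there, and homogeneity of
  degree two extends the bound to every \<open>y\<close>.\<close>

lemma rayleigh_quotient_max:
  assumes "n > 0"
  obtains x l where "sq_norm_upto n x = 1" "quad_form n d x = l"
    "\<And>y. quad_form n d y \<le> l * sq_norm_upto n y"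
proof -
  define B :: "(nat \<Rightarrow> real) set" where
    \<comment> \<open>Fixing the coordinates from \<open>n\<close> on to 0 makes the cube a product
      of compact sets in the space of all functions; the unit sphere \<open>S\<close> is closed in
      it.\<close>
    "B = PiE UNIV (\<lambda>i. if i < n then {-1..1} else {0})"
  have "compactin (product_topology (\<lambda>i::nat. euclidean :: real topology) UNIV) B"
    unfolding B_def by (subst compactin_PiE) auto
  then have "compact B"
    by (simp add: euclidean_product_topology)
  have cn: "continuous_on UNIV (sq_norm_upto n)"
    unfolding sq_norm_upto_def by (intro continuous_intros continuous_on_product_coordinates)
  have cq: "continuous_on UNIV (quad_form n d)"
    unfolding quad_form_def by (intro continuous_intros continuous_on_product_coordinates)
  define S where "S = B \<inter> sq_norm_upto n -` {1}"
  have "closed (sq_norm_upto n -` {1})"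
    using cn by (intro closed_vimage) auto
  with \<open>compact B\<close> have "compact S"
    unfolding S_def by blast
  have normalise: "(\<lambda>i. if i < n then y i / sqrt (sq_norm_upto n y) else 0) \<in> S"
    if "sq_norm_upto n y > 0" for y
  proof -
    have "\<bar>y i\<bar> \<le> sqrt (sq_norm_upto n y)" if "i < n" for i
    proof -
      have "(y i)\<^sup>2 \<le> sq_norm_upto n y"
        unfolding sq_norm_upto_def using that by (intro member_le_sum) auto
      then show ?thesis
        using real_sqrt_le_mono[of "(y i)\<^sup>2"] by simp
    qed
    then have "(\<lambda>i. if i < n then y i / sqrt (sq_norm_upto n y) else 0) \<in> B"
      using that unfolding B_def
      by (auto simp: abs_le_iff divide_le_eq le_divide_eq minus_le_iff)
    moreover have "sq_norm_upto n (\<lambda>i. if i < n then y i / sqrt (sq_norm_upto n y) else 0) =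
        (\<Sum>i<n. (y i)\<^sup>2) / sq_norm_upto n y"
      using that unfolding sq_norm_upto_def
      by (simp add: power_divide sum_nonneg flip: sum_divide_distrib)
    ultimately show ?thesis
      using that unfolding S_def by (simp add: sq_norm_upto_def)
  qed
  have "S \<noteq> {}"
    using normalise[of "\<lambda>_. 1"] assms by (auto simp: sq_norm_upto_def)
  then obtain x where x: "x \<in> S" "\<And>y. y \<in> S \<Longrightarrow> quad_form n d y \<le> quad_form n d x"
    using continuous_attains_sup[OF \<open>compact S\<close>] continuous_on_subset[OF cq] by blast
  have "quad_form n d y \<le> quad_form n d x * sq_norm_upto n y" for y
  proof (cases "\<forall>i<n. y i = 0")
    case True
    then show ?thesis
      by (simp add: quad_form_def sq_norm_upto_def)
  next
    case False
    let ?s = "sq_norm_upto n y"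
    have s: "?s > 0"
      using False sq_norm_upto_pos[of n y] by blast
    have "quad_form n d (\<lambda>i. if i < n then y i / sqrt ?s else 0) =
        quad_form n d (\<lambda>i. (1 / sqrt ?s) * y i)"
      unfolding quad_form_def by (intro sum.cong refl) auto
    also have "\<dots> = quad_form n d y / ?s"
      using s by (subst quad_form_scale) (simp add: power_divide)
    finally have "quad_form n d y / ?s \<le> quad_form n d x"
      using x(2)[OF normalise[OF s]] by simp
    then show ?thesis
      using s by (simp add: divide_le_eq)
  qed
  moreover have "sq_norm_upto n x = 1"
    using x(1) by (simp add: S_def)
  ultimately show ?thesis
    using that by blast
qed

text \<open>First variation of the Rayleigh quotient in the direction of a unit vector.\<close>

lemma rayleigh_maximiser_eigenvector:
  assumes sym: "\<And>i j. i < n \<Longrightarrow> j < n \<Longrightarrow> d i j = d j i"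
    and le: "\<And>y. quad_form n d y \<le> l * sq_norm_upto n y"
    and eq: "quad_form n d x = l * sq_norm_upto n x"
    and "i < n"
  shows "(\<Sum>j<n. d i j * x j) = l * x i"
proof -
  define p where "p = (\<Sum>j<n. d i j * x j) - l * x i"
  define q where "q = d i i - l"
  \<comment> \<open>The left side is the change of \<open>quad_form n d - l * sq_norm_upto n\<close>
    when \<open>t\<close> is added to entry \<open>i\<close> of \<open>x\<close>. This difference is
    zero at \<open>x\<close> and never positive.\<close>
  have step: "2 * t * p + t\<^sup>2 * q \<le> 0" for t
  proof -
    define e :: "nat \<Rightarrow> real" where "e j = (if j = i then t else 0)" for j
    define y where "y j = x j + e j" for j
    have "quad_form n d y = quad_form n d x + (\<Sum>a<n. \<Sum>j<n. d a j * e a * x j)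
        + (\<Sum>a<n. \<Sum>j<n. d a j * x a * e j) + (\<Sum>a<n. \<Sum>j<n. d a j * e a * e j)"
      unfolding quad_form_def y_def by (simp add: algebra_simps sum.distrib)
    also have "(\<Sum>a<n. \<Sum>j<n. d a j * e a * x j) = (\<Sum>a<n. if a = i then t * (\<Sum>j<n. d i j * x j) else 0)"
      unfolding e_def by (intro sum.cong refl) (auto simp: sum_distrib_left algebra_simps)
    also have "\<dots> = t * (\<Sum>j<n. d i j * x j)"
      using \<open>i < n\<close> by (simp add: sum.delta)
    also have "(\<Sum>a<n. \<Sum>j<n. d a j * x a * e j) = (\<Sum>a<n. \<Sum>j<n. d j a * x a * e j)"
      using sym by (intro sum.cong refl) auto
    also have "\<dots> = (\<Sum>j<n. \<Sum>a<n. d j a * x a * e j)"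
      by (rule sum.swap)
    also have "\<dots> = (\<Sum>a<n. if a = i then t * (\<Sum>j<n. d i j * x j) else 0)"
      unfolding e_def by (intro sum.cong refl) (auto simp: sum_distrib_left algebra_simps)
    also have "\<dots> = t * (\<Sum>j<n. d i j * x j)"
      using \<open>i < n\<close> by (simp add: sum.delta)
    also have "(\<Sum>a<n. \<Sum>j<n. d a j * e a * e j) = t\<^sup>2 * d i i"
      using \<open>i < n\<close> unfolding e_def
      by (simp add: if_distrib[of "\<lambda>u. _ * u"] if_distrib[of "\<lambda>u. u * _"] sum.delta
          power2_eq_square cong: if_cong)
    finally have Q: "quad_form n d y = quad_form n d x + 2 * t * (\<Sum>j<n. d i j * x j) + t\<^sup>2 * d i i"
      by simp
    have "sq_norm_upto n y = (\<Sum>j<n. (x j)\<^sup>2 + (if j = i then 2 * t * x i + t\<^sup>2 else 0))"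
      unfolding sq_norm_upto_def y_def e_def
      by (intro sum.cong refl) (auto simp: power2_eq_square algebra_simps)
    also have "\<dots> = sq_norm_upto n x + 2 * t * x i + t\<^sup>2"
      using \<open>i < n\<close> by (simp add: sum.distrib sum.delta sq_norm_upto_def)
    finally show ?thesis
      using le[of y] eq unfolding Q p_def q_def by (simp add: algebra_simps)
  qed
  \<comment> \<open>A quadratic in \<open>t\<close> that is never positive and vanishes at 0 has no
    linear term: \<open>s\<close> is so large that the value at \<open>t = p / s\<close> is a
    positive multiple of \<open>p\<^sup>2\<close>.\<close>
  define s where "s = \<bar>q\<bar> + 1"
  have "s > 0" "2 * s + q > 0"
    unfolding s_def using abs_ge_minus_self[of q] abs_ge_zero[of q] by (simp_all add: algebra_simps)
  have "p\<^sup>2 * (2 * s + q) = s\<^sup>2 * (2 * (p / s) * p + (p / s)\<^sup>2 * q)"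
    using \<open>s > 0\<close> by (simp add: field_simps power2_eq_square)
  also have "\<dots> \<le> 0"
    using step[of "p / s"] by (simp add: mult_nonneg_nonpos)
  finally have "p = 0"
    using \<open>2 * s + q > 0\<close> by (simp add: mult_le_0_iff)
  then show ?thesis
    by (simp add: p_def)
qed

lemma quad_form_eigenvector:
  assumes "\<forall>i<n. (\<Sum>j<n. d i j * x j) = l * x i"
  shows "quad_form n d x = l * sq_norm_upto n x"
proof -
  have "quad_form n d x = (\<Sum>i<n. x i * (\<Sum>j<n. d i j * x j))"
    unfolding quad_form_def by (simp add: sum_distrib_left algebra_simps)
  also have "\<dots> = (\<Sum>i<n. x i * (l * x i))"
    using assms by (intro sum.cong) auto
  also have "\<dots> = l * sq_norm_upto n x"
    unfolding sq_norm_upto_def by (simp add: sum_distrib_left power2_eq_square algebra_simps)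
  finally show ?thesis .
qed

text \<open>Triangle inequality. Taking absolute values keeps the norm and does not lower the form,
  so a maximiser may be taken entrywise nonnegative.\<close>

lemma quad_form_abs_ge:
  assumes "\<And>i j. i < n \<Longrightarrow> j < n \<Longrightarrow> d i j \<ge> 0"
  shows "\<bar>quad_form n d x\<bar> \<le> quad_form n d (\<lambda>i. \<bar>x i\<bar>)"
proof -
  have "\<bar>quad_form n d x\<bar> \<le> (\<Sum>i<n. \<Sum>j<n. \<bar>d i j * x i * x j\<bar>)"
    unfolding quad_form_def by (intro order.trans[OF sum_abs] sum_mono order.refl)
  also have "\<dots> = quad_form n d (\<lambda>i. \<bar>x i\<bar>)"
    unfolding quad_form_def using assms by (intro sum.cong refl) (auto simp: abs_mult)
  finally show ?thesis .
qed

lemma sq_norm_upto_abs: "sq_norm_upto n (\<lambda>i. \<bar>x i\<bar>) = sq_norm_upto n x"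
  by (simp add: sq_norm_upto_def)

text \<open>For \<open>n = 2\<close> the uniqueness of the eigenvalue of largest modulus fails. For \<open>n \<ge> 3\<close>, an eigenvector for
  \<open>- l\<close> would have entries of pairwise opposite signs.\<close>

lemma perron_largest_eigenvalue:
  fixes d :: "nat \<Rightarrow> nat \<Rightarrow> real"
  assumes n: "n \<ge> 3"
    and sym: "\<And>i j. i < n \<Longrightarrow> j < n \<Longrightarrow> d i j = d j i"
    and pos: "\<And>i j. i < n \<Longrightarrow> j < n \<Longrightarrow> i \<noteq> j \<Longrightarrow> d i j > 0"
    and diag: "\<And>i. i < n \<Longrightarrow> d i i = 0"
  obtains l x where
    "(THE l. is_arg_max abs (eigenvalue (Matrix.mat n n (\<lambda>(i, j). d i j))) l) = l"
    "\<And>i. i < n \<Longrightarrow> x i > 0"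
    "\<And>i. i < n \<Longrightarrow> (\<Sum>j<n. d i j * x j) = l * x i"
    "\<And>y. quad_form n d y \<le> l * sq_norm_upto n y"
proof -
  let ?E = "eigenvalue (Matrix.mat n n (\<lambda>(i, j). d i j))"
  have nonneg: "d i j \<ge> 0" if "i < n" "j < n" for i j
    using pos[OF that] diag[OF that(1)] by (cases "i = j") auto
  obtain z l where z: "sq_norm_upto n z = 1" "quad_form n d z = l"
    and le: "\<And>y. quad_form n d y \<le> l * sq_norm_upto n y"
    using rayleigh_quotient_max[of n d] n by auto
  \<comment> \<open>The absolute values of such a \<open>y\<close> maximise the Rayleigh quotient
    and hence form an eigenvector for \<open>l\<close>. A zero entry would force all others to
    vanish, the off-diagonal entries of \<open>d\<close> being positive.\<close>
  have extremal: "(\<forall>i<n. \<bar>y i\<bar> > 0) \<and> (\<forall>i<n. (\<Sum>j<n. d i j * \<bar>y j\<bar>) = l * \<bar>y i\<bar>)"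
    if y: "\<exists>i<n. y i \<noteq> 0" and qy: "quad_form n d (\<lambda>i. \<bar>y i\<bar>) \<ge> l * sq_norm_upto n y" for y
  proof -
    have ev: "(\<Sum>j<n. d i j * \<bar>y j\<bar>) = l * \<bar>y i\<bar>" if "i < n" for i
      using that le[of "\<lambda>i. \<bar>y i\<bar>"] qy sq_norm_upto_abs[of n y]
      by (intro rayleigh_maximiser_eigenvector sym le) auto
    have "\<bar>y i\<bar> > 0" if i: "i < n" for i
    proof (rule ccontr)
      assume "\<not> \<bar>y i\<bar> > 0"
      then have "(\<Sum>j<n. d i j * \<bar>y j\<bar>) = 0" and "y i = 0"
        using ev[OF i] by auto
      then have "\<forall>j<n. d i j * \<bar>y j\<bar> = 0"
        using nonneg i by (subst (asm) sum_nonneg_eq_0_iff) auto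
      then have "y j = 0" if "j < n" for j
        using that pos[OF i that] \<open>y i = 0\<close> by (cases "i = j") force+
      with y show False by blast
    qed
    with ev show ?thesis by blast
  qed
  define x where "x i = \<bar>z i\<bar>" for i
  have "\<exists>i<n. z i \<noteq> 0"
    using z(1) sq_norm_upto_eq_0_iff[of n z] by auto
  then have "(\<forall>i<n. x i > 0) \<and> (\<forall>i<n. (\<Sum>j<n. d i j * x j) = l * x i)"
    unfolding x_def using extremal[of z] quad_form_abs_ge[of n d z] nonneg z by auto
  then have x: "\<And>i. i < n \<Longrightarrow> x i > 0"
      "\<And>i. i < n \<Longrightarrow> (\<Sum>j<n. d i j * x j) = l * x i"
    by auto
  have "(\<Sum>j<n. d 0 j * x j) \<ge> 0"
    using x(1) nonneg n by (intro sum_nonneg mult_nonneg_nonneg) (auto intro: less_imp_le)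
  then have "l * x 0 \<ge> 0"
    using x(2)[of 0] n by simp
  then have l: "l \<ge> 0"
    using x(1)[of 0] n by (simp add: zero_le_mult_iff)
  have "?E l"
    unfolding eigenvalue_mat_iff using x n by (intro exI[of _ x]) (auto intro!: exI[of _ 0] dest: x(1) simp: less_le)
  have bound: "\<bar>\<mu>\<bar> \<le> l \<and> \<mu> \<noteq> - l \<or> \<mu> = l" if \<mu>: "?E \<mu>" for \<mu>
  proof -
    obtain y where y: "\<exists>i<n. y i \<noteq> 0" "\<forall>i<n. (\<Sum>j<n. d i j * y j) = \<mu> * y i"
      using \<mu> unfolding eigenvalue_mat_iff by blast
    have q: "quad_form n d y = \<mu> * sq_norm_upto n y"
      using y(2) by (rule quad_form_eigenvector)
    note N = sq_norm_upto_pos[OF y(1)]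
    have abs_le: "\<bar>\<mu>\<bar> * sq_norm_upto n y \<le> quad_form n d (\<lambda>i. \<bar>y i\<bar>)"
      using quad_form_abs_ge[of n d y] nonneg N unfolding q by (simp add: abs_mult)
    also have "\<dots> \<le> l * sq_norm_upto n y"
      using le[of "\<lambda>i. \<bar>y i\<bar>"] by (simp add: sq_norm_upto_abs)
    finally have "\<bar>\<mu>\<bar> \<le> l"
      using N by simp
    moreover have "\<mu> = l" if \<mu>: "\<mu> = - l"
    proof (rule ccontr)
      have ext: "\<And>i. i < n \<Longrightarrow> \<bar>y i\<bar> > 0" "\<And>i. i < n \<Longrightarrow> (\<Sum>j<n. d i j * \<bar>y j\<bar>) = l * \<bar>y i\<bar>"
        using extremal[OF y(1)] abs_le \<mu> l by auto
      \<comment> \<open>Row \<open>i\<close> of the equation for the absolute values, times the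
        absolute value of \<open>y i\<close>, plus row \<open>i\<close> of the equation for
        \<open>y\<close>, times \<open>y i\<close>, gives a vanishing sum of nonnegative
        terms.\<close>
      have opp: "y i * y j < 0" if "i < n" "j < n" "i \<noteq> j" for i j
      proof -
        have "(\<Sum>j<n. d i j * (\<bar>y i\<bar> * \<bar>y j\<bar> + y i * y j)) =
            \<bar>y i\<bar> * (\<Sum>j<n. d i j * \<bar>y j\<bar>) + y i * (\<Sum>j<n. d i j * y j)"
          by (simp add: sum_distrib_left sum.distrib algebra_simps)
        also have "\<dots> = 0"
          using ext(2)[OF that(1)] y(2) that(1) \<mu> by (simp add: algebra_simps)
        finally have "\<forall>j<n. d i j * (\<bar>y i\<bar> * \<bar>y j\<bar> + y i * y j) = 0"
          using nonneg that(1)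
          by (subst (asm) sum_nonneg_eq_0_iff) (auto simp flip: abs_mult)
        then have "\<bar>y i\<bar> * \<bar>y j\<bar> + y i * y j = 0"
          using pos[OF that] that by force
        moreover have "\<bar>y i\<bar> * \<bar>y j\<bar> > 0"
          using ext(1) that by simp
        ultimately show ?thesis by linarith
      qed
      have "y 0 * y 1 < 0" "y 0 * y 2 < 0" "y 1 * y 2 < 0"
        using n by (auto intro!: opp)
      then show False
        by (auto simp: mult_less_0_iff)
    qed
    ultimately show ?thesis by auto
  qed
  have "(THE l. is_arg_max abs ?E l) = l"
  proof (rule the_equality)
    show "is_arg_max abs ?E l"
      unfolding is_arg_max_def using \<open>?E l\<close> bound l by force
  next
    fix \<mu> assume \<mu>: "is_arg_max abs ?E \<mu>"
    then have "?E \<mu>" "\<not> \<bar>\<mu>\<bar> < \<bar>l\<bar>"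
      unfolding is_arg_max_def using \<open>?E l\<close> by auto
    with bound[of \<mu>] l show "\<mu> = l"
      by auto
  qed
  with x le that show ?thesis by blast
qed

section \<open>Bridges in finite connected graphs\<close>

locale fin_conn_graph =
  fixes V :: "'a set" and E :: "('a \<times> 'a) set"
  assumes finite_V: "finite V"
    and E_in_V: "E \<subseteq> V \<times> V"
    and E_sym: "(u, v) \<in> E \<Longrightarrow> (v, u) \<in> E"
    and E_irrefl: "(v, v) \<notin> E"
    and E_connected: "u \<in> V \<Longrightarrow> v \<in> V \<Longrightarrow> (u, v) \<in> E\<^sup>*"
begin

definition del :: "'a \<Rightarrow> 'a \<Rightarrow> ('a \<times> 'a) set" where
  "del u v = E - {(u, v), (v, u)}"

definition bridges :: "('a \<times> 'a) set" where
  "bridges = {(u, v) \<in> E. (u, v) \<notin> (del u v)\<^sup>*}"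

text \<open>Each bridge in its orientation away from \<open>r\<close>: the tail is the end that
  \<open>r\<close> still reaches once the bridge is deleted.\<close>

definition down :: "'a \<Rightarrow> ('a \<times> 'a) set" where
  "down r = {(u, v) \<in> bridges. (r, u) \<in> (del u v)\<^sup>*}"

definition far :: "'a \<Rightarrow> 'a set" where
  "far r = snd ` down r"

lemma E_V: assumes "(u, v) \<in> E" shows "u \<in> V" "v \<in> V"
  using assms E_in_V by auto

lemma del_commute: "del u v = del v u"
  unfolding del_def by auto

lemma del_subset: "del u v \<subseteq> E"
  unfolding del_def by auto

lemma del_rtrancl_sym: "(a, b) \<in> (del u v)\<^sup>* \<Longrightarrow> (b, a) \<in> (del u v)\<^sup>*"
proof -
  have "sym (del u v)"
    unfolding del_def using E_sym by (auto intro: symI)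
  then show "(a, b) \<in> (del u v)\<^sup>* \<Longrightarrow> (b, a) \<in> (del u v)\<^sup>*"
    by (meson sym_rtrancl symD)
qed

lemma bridges_sym: "(u, v) \<in> bridges \<Longrightarrow> (v, u) \<in> bridges"
  unfolding bridges_def using E_sym del_rtrancl_sym del_commute[of u v] by auto

lemma bridges_rtrancl_sym: "(u, v) \<in> bridges\<^sup>* \<Longrightarrow> (v, u) \<in> bridges\<^sup>*"
  by (meson bridges_sym sym_def sym_rtrancl)

lemma bridgesD:
  assumes "(u, v) \<in> bridges"
  shows "(u, v) \<in> E" "u \<in> V" "v \<in> V" "u \<noteq> v" "(u, v) \<notin> (del u v)\<^sup>*"
  using assms E_V unfolding bridges_def by auto

lemma finite_bridges: "finite bridges"
  by (rule finite_subset[of _ "V \<times> V"]) (use bridgesD(2,3) finite_V in auto)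

text \<open>Follow a walk from \<open>w\<close> to \<open>u\<close> up to its first use of the
  deleted edge, which starts at \<open>u\<close> or \<open>v\<close>.\<close>

lemma del_reaches_end:
  assumes "u \<in> V" "w \<in> V"
  shows "(w, u) \<in> (del u v)\<^sup>* \<or> (w, v) \<in> (del u v)\<^sup>*"
  using E_connected[OF assms(2,1)]
proof (induction rule: converse_rtrancl_induct)
  case (step y z)
  then show ?case
    by (cases "(y, z) \<in> del u v") (auto simp: del_def intro: converse_rtrancl_into_rtrancl)
qed auto

lemma downD:
  assumes "(u, v) \<in> down r"
  shows "(u, v) \<in> bridges" "(r, u) \<in> (del u v)\<^sup>*" "(r, v) \<notin> (del u v)\<^sup>*"
proof -
  show *: "(u, v) \<in> bridges" "(r, u) \<in> (del u v)\<^sup>*"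
    using assms unfolding down_def by auto
  show "(r, v) \<notin> (del u v)\<^sup>*"
    using bridgesD(5)[OF *(1)] del_rtrancl_sym[OF *(2)] by (meson rtrancl_trans)
qed

lemma finite_down: "finite (down r)"
  by (rule finite_subset[OF _ finite_bridges]) (use downD(1) in auto)

lemma bridges_down:
  assumes "(u, v) \<in> bridges" "r \<in> V"
  shows "(u, v) \<in> down r \<or> (v, u) \<in> down r"
  using del_reaches_end[of u r v] bridgesD(2)[OF assms(1)] bridges_sym[OF assms(1)] assms
  by (auto simp: down_def del_commute)

text \<open>A walk from \<open>r\<close> to \<open>u'\<close> without the edge \<open>u' v\<close>
  cannot meet \<open>v\<close>, so it does not use the edge \<open>u v\<close> either. If
  \<open>u \<noteq> u'\<close>, it extends along \<open>u' v\<close> to \<open>v\<close>, although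
  deleting \<open>u v\<close> cuts \<open>v\<close> off from \<open>r\<close>.\<close>

lemma down_inj:
  assumes 1: "(u, v) \<in> down r" and 2: "(u', v) \<in> down r"
  shows "u = u'"
proof (rule ccontr)
  assume ne: "u \<noteq> u'"
  have "(r, w) \<in> (del u v)\<^sup>*" if "(r, w) \<in> (del u' v)\<^sup>*" for w
    using that
  proof (induction rule: rtrancl_induct)
    case (step y z)
    have "y \<noteq> v" "z \<noteq> v"
      using step(1,2) downD(3)[OF 2] by (auto dest: rtrancl_into_rtrancl)
    then have "(y, z) \<in> del u v"
      using step(2) unfolding del_def by auto
    with step show ?case by auto
  qed auto
  then have "(r, u') \<in> (del u v)\<^sup>*"
    using downD(2)[OF 2] .
  moreover have "(u', v) \<in> del u v"
    using bridgesD[OF downD(1)[OF 2]] ne unfolding del_def by auto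
  ultimately show False
    using downD(3)[OF 1] by (auto dest: rtrancl_into_rtrancl)
qed

lemma far_subset: "far r \<subseteq> V - {r}"
  unfolding far_def using bridgesD(3) downD by fastforce

lemma finite_far: "finite (far r)"
  using far_subset finite_V by (meson finite_Diff finite_subset)

lemma card_far_eq_down: "card (far r) = card (down r)"
  unfolding far_def by (rule card_image) (auto simp: inj_on_def dest: down_inj)

text \<open>Exactly one orientation of each bridge points away from \<open>r\<close>. In particular,
  the number of far ends does not depend on the root.\<close>

lemma card_far:
  assumes "r \<in> V"
  shows "card (far r) = card {{u, v} | u v. (u, v) \<in> bridges}"
proof -
  have "(v, u) \<notin> down r" if "(u, v) \<in> down r" for u v
    using that downD(2,3) del_commute by metis
  then have "inj_on (\<lambda>(u, v). {u, v}) (down r)"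
    by (auto simp: inj_on_def doubleton_eq_iff)
  moreover have "(\<lambda>(u, v). {u, v}) ` down r = {{u, v} | u v. (u, v) \<in> bridges}"
    using bridges_down[OF _ assms] downD(1) by (fastforce simp: insert_commute image_iff)
  ultimately have "card {{u, v} | u v. (u, v) \<in> bridges} = card (down r)"
    by (metis card_image)
  then show ?thesis
    by (simp add: card_far_eq_down)
qed

text \<open>The component of \<open>s\<close> in the bridge forest consists of the vertices below \<open>s\<close>: by
  \<open>down_inj\<close> the only way up from a vertex is the way it was reached.\<close>

lemma bridge_component_down:
  assumes "r \<in> V" "s \<notin> far r" "(s, w) \<in> bridges\<^sup>*"
  shows "(s, w) \<in> (down r)\<^sup>*"
  using assms(3)
proof (induction rule: rtrancl_induct)
  case (step y z)
  from bridges_down[OF step(2) assms(1)] show ?case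
  proof
    assume "(y, z) \<in> down r"
    with step show ?case by auto
  next
    assume zy: "(z, y) \<in> down r"
    then have "y \<noteq> s"
      using assms(2) by (force simp: far_def)
    with step(3) obtain z' where "(s, z') \<in> (down r)\<^sup>*" "(z', y) \<in> down r"
      by (metis rtranclE)
    with zy show ?case
      using down_inj by metis
  qed
qed auto

text \<open>By \<open>bridge_component_down\<close>, bridges lead from \<open>s\<close> only
  downwards, and every nontrivial descent ends in \<open>far r\<close>. So each component of the
  bridge forest has at most one vertex outside \<open>far r\<close>.\<close>

lemma near_not_bridge_connected:
  assumes "r \<in> V" "s \<notin> far r" "t \<notin> far r" "s \<noteq> t"
  shows "(s, t) \<notin> bridges\<^sup>*"
proof
  assume "(s, t) \<in> bridges\<^sup>*"
  then have "(s, t) \<in> (down r)\<^sup>*"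
    using assms bridge_component_down by blast
  then show False
    using assms(3,4) by (cases rule: rtranclE) (force simp: far_def)+
qed

section \<open>Separating bridges and the length of walks\<close>

definition separating :: "'a \<Rightarrow> 'a \<Rightarrow> 'a \<Rightarrow> ('a \<times> 'a) set" where
  "separating r s t = {(u, v) \<in> down r. (s, t) \<notin> (del u v)\<^sup>*}"

lemma finite_separating: "finite (separating r s t)"
  unfolding separating_def by (rule finite_subset[OF _ finite_down]) auto

text \<open>Each new edge of the walk pays for one unit. A bridge adds at most itself to the
  separating bridges and does not affect whether the ends are joined by bridges. Any other edge adds
  no separating bridge and pays for the second term.\<close>

lemma walk_length_ge:
  assumes r: "r \<in> V" and "(s, t) \<in> E ^^ l"
  shows "card (separating r s t) + of_bool ((s, t) \<notin> bridges\<^sup>*) \<le> l"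
  using assms(2)
proof (induction l arbitrary: t)
  case 0
  then show ?case
    by (auto simp: separating_def)
next
  case (Suc l)
  then obtain w where w: "(s, w) \<in> E ^^ l" "(w, t) \<in> E"
    by auto
  have via: "(s, t) \<in> (del u v)\<^sup>*" if "(s, w) \<in> (del u v)\<^sup>*" "(w, t) \<in> del u v" for u v
    using that by (rule rtrancl_into_rtrancl)
  show ?case
  proof (cases "(w, t) \<in> bridges")
    case False
    have "(s, w) \<notin> (del u v)\<^sup>*" if "(u, v) \<in> separating r s t" for u v
    proof -
      have "(u, v) \<in> bridges"
        using that downD(1) by (auto simp: separating_def)
      then have "(w, t) \<in> del u v"
        using False w(2) bridges_sym by (auto simp: del_def)
      then show ?thesis
        using via that by (auto simp: separating_def)
    qed
    then have "separating r s t \<subseteq> separating r s w"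
      by (auto simp: separating_def)
    then have "card (separating r s t) \<le> card (separating r s w)"
      by (intro card_mono finite_separating)
    with Suc.IH[OF w(1)] show ?thesis
      by auto
  next
    case True
    have "separating r s t \<subseteq> insert (if (w, t) \<in> down r then (w, t) else (t, w)) (separating r s w)"
    proof (clarify)
      fix u v
      assume *: "(u, v) \<in> separating r s t" "(u, v) \<notin> separating r s w"
      then have "(w, t) \<notin> del u v"
        using via by (auto simp: separating_def)
      then have "(u, v) = (w, t) \<or> (u, v) = (t, w)"
        using w(2) by (auto simp: del_def)
      moreover have "(u, v) \<in> down r"
        using * by (auto simp: separating_def)
      moreover have "(t, w) \<notin> down r" if "(w, t) \<in> down r"
        using that downD(2,3) del_commute by metis
      ultimately show "(u, v) = (if (w, t) \<in> down r then (w, t) else (t, w))"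
        by auto
    qed
    then have "card (separating r s t) \<le> card (insert (if (w, t) \<in> down r then (w, t) else (t, w)) (separating r s w))"
      by (intro card_mono) (auto simp: finite_separating)
    also have "\<dots> \<le> Suc (card (separating r s w))"
      by (simp add: card_insert_if finite_separating)
    finally have "card (separating r s t) \<le> Suc (card (separating r s w))" .
    moreover have "(s, w) \<notin> bridges\<^sup>*" if "(s, t) \<notin> bridges\<^sup>*"
      using that True rtrancl_into_rtrancl[of s w bridges t] by blast
    ultimately show ?thesis
      using Suc.IH[OF w(1)] by (auto simp: of_bool_def split: if_splits)
  qed
qed

text \<open>Whatever follows the last visit to \<open>x\<close> is a walk that avoids
  \<open>x\<close>.\<close>

lemma rtrancl_last_departure:
  assumes "(s, y) \<in> F\<^sup>*" "y \<noteq> x"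
  shows "(s, y) \<in> (F - {x} \<times> UNIV - UNIV \<times> {x})\<^sup>* \<or>
    (\<exists>z. (x, z) \<in> F \<and> (z, y) \<in> (F - {x} \<times> UNIV - UNIV \<times> {x})\<^sup>*)"
    (is "_ \<in> ?G\<^sup>* \<or> _")
  using assms(1)
proof (induction rule: converse_rtrancl_induct)
  case (step s s')
  have "s' \<noteq> x" if "(s', y) \<in> ?G\<^sup>*"
    using that assms(2) by (auto elim: converse_rtranclE)
  with step show ?case
    by (cases "s = x") (auto intro: converse_rtrancl_into_rtrancl)
qed auto

text \<open>An edge that is not a bridge lies on a cycle, and no vertex of a cycle through the root
  is the far end of a bridge.\<close>

lemma card_near_ge_3:
  assumes xy: "(x, y) \<in> E" "(x, y) \<notin> bridges"
  shows "card (V - far x) \<ge> 3"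
proof -
  have "(x, y) \<in> (del x y)\<^sup>*" "x \<noteq> y"
    using assms E_irrefl by (auto simp: bridges_def)
  let ?G = "del x y - {x} \<times> UNIV - UNIV \<times> {x}"
  have "(x, y) \<notin> ?G\<^sup>*"
    using \<open>x \<noteq> y\<close> by (auto elim: converse_rtranclE)
  \<comment> \<open>\<open>z\<close> is the other neighbour of \<open>x\<close> on a cycle through
    the edge \<open>x y\<close>; the edge \<open>x z\<close> lies on this cycle too, so it is not a
    bridge.\<close>
  with rtrancl_last_departure[OF \<open>(x, y) \<in> (del x y)\<^sup>*\<close>, of x] \<open>x \<noteq> y\<close>
  obtain z where z: "(x, z) \<in> del x y" "(z, y) \<in> ?G\<^sup>*"
    by auto
  have xz: "(x, z) \<in> E" "z \<noteq> y" "z \<noteq> x"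
    using z(1) E_irrefl by (auto simp: del_def)
  have "?G \<subseteq> del x z"
    by (auto simp: del_def)
  then have "(z, y) \<in> (del x z)\<^sup>*"
    using z(2) rtrancl_mono by blast
  moreover have "(y, x) \<in> del x z"
    using E_sym[OF xy(1)] xz \<open>x \<noteq> y\<close> by (auto simp: del_def)
  ultimately have "(x, z) \<in> (del x z)\<^sup>*"
    using del_rtrancl_sym by (meson rtrancl.rtrancl_into_rtrancl)
  then have "(x, z) \<notin> bridges"
    by (auto simp: bridges_def)
  \<comment> \<open>Here \<open>x\<close> is the root, and deleting a bridge does not touch the edge
    \<open>x w\<close>; so no bridge separates \<open>w\<close> from \<open>x\<close>.\<close>
  have near: "w \<notin> far x" if w: "(x, w) \<in> E" "(x, w) \<notin> bridges" for w
  proof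
    assume "w \<in> far x"
    then obtain u where u: "(u, w) \<in> down x"
      by (auto simp: far_def)
    then have "(x, w) \<in> del u w"
      using w downD(1)[OF u] bridgesD(4) by (auto simp: del_def)
    then show False
      using downD(3)[OF u] by auto
  qed
  have "{x, y, z} \<subseteq> V - far x"
    using near[OF xy] near[OF xz(1) \<open>(x, z) \<notin> bridges\<close>] far_subset[of x] E_V[OF xy(1)] E_V[OF xz(1)]
    by auto
  then have "card {x, y, z} \<le> card (V - far x)"
    using finite_V by (intro card_mono) auto
  then show ?thesis
    using xz \<open>x \<noteq> y\<close> by simp
qed

lemma card_near: "card (V - far r) = card V - card (far r)"
  using far_subset[of r] by (intro card_Diff_subset finite_far) auto

lemma far_card_less:
  assumes "r \<in> V" shows "card (far r) < card V"
  using far_subset[of r] assms finite_V by (intro psubset_card_mono) auto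

text \<open>Two vertices outside \<open>far r\<close> are not joined by bridges, so some edge is not
  a bridge. Moving the root to an end of it keeps the number of far ends, but
  \<open>card_near_ge_3\<close> then yields three vertices that are not far. Thus the number of cut
  edges is never \<open>n - 2\<close>.\<close>

lemma card_near_ne_2:
  assumes "r \<in> V"
  shows "card V - card (far r) \<noteq> 2"
proof
  assume 2: "card V - card (far r) = 2"
  then have "card (V - far r) = 2"
    using card_near by simp
  then obtain s t where st: "V - far r = {s, t}" "s \<noteq> t"
    by (meson card_2_iff)
  have "s \<in> V" "t \<in> V" "s \<notin> far r" "t \<notin> far r"
    using st by auto
  then have "(s, t) \<notin> bridges\<^sup>*" "(s, t) \<in> E\<^sup>*"
    using near_not_bridge_connected[OF assms] st(2) E_connected by auto
  then have "\<not> E \<subseteq> bridges"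
    using rtrancl_mono by blast
  then obtain x y where xy: "(x, y) \<in> E" "(x, y) \<notin> bridges"
    by auto
  have "card (far x) = card (far r)"
    using card_far[OF assms] card_far[OF E_V(1)[OF xy(1)]] by simp
  with card_near_ge_3[OF xy] 2 show False
    by (simp add: card_near)
qed

end

section \<open>The weighted sum of distances\<close>

text \<open>Since \<open>r\<close> is not a leaf, \<open>c < a + b\<close> makes the root side of
  every bridge heavier than \<open>c\<close>. The inequality \<open>b < c + a\<close> penalises far
  ends that bridges do not join to \<open>r\<close>. Suitable values come from
  \<open>K_pendant_perron\<close>.\<close>

locale labelled_conn_graph = fin_conn_graph +
  fixes r :: 'a and a b c :: real
  assumes r_V: "r \<in> V"
    and r_not_leaf: "\<exists>s t. s \<noteq> t \<and> (r, s) \<in> E \<and> (r, t) \<in> E"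
    and r_bridge: "bridges \<noteq> {} \<Longrightarrow> \<exists>p. (r, p) \<in> bridges"
    and label_pos: "a > 0" "b > 0" "c > 0"
    and label_less: "c < a + b" "b < c + a"
begin

definition label :: "'a \<Rightarrow> real" where
  "label v = (if v = r then a else if v \<in> far r then c else b)"

definition k :: real where "k = real (card (far r))"

definition m :: real where "m = real (card V - card (far r) - 1)"

definition total :: real where "total = sum label V"

abbreviation (input) near :: "'a set" where "near \<equiv> V - far r"

lemma r_near: "r \<in> near"
  using far_subset r_V by auto

lemma label_positive: "label v > 0"
  using label_pos by (simp add: label_def)

lemma label_far: "p \<in> far r \<Longrightarrow> label p = c"
  using far_subset by (auto simp: label_def)

lemma card_near': "real (card (near - {r})) = m"
  using r_near card_near[of r] finite_V by (simp add: m_def)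

lemma sum_near: "(\<Sum>v\<in>near. f (label v)) = f a + m * f b" for f :: "real \<Rightarrow> real"
proof -
  have "(\<Sum>v\<in>near. f (label v)) = f (label r) + (\<Sum>v\<in>near - {r}. f (label v))"
    using r_near finite_V by (intro sum.remove) auto
  also have "(\<Sum>v\<in>near - {r}. f (label v)) = (\<Sum>v\<in>near - {r}. f b)"
    by (intro sum.cong) (auto simp: label_def)
  finally show ?thesis
    using card_near' by (simp add: label_def)
qed

lemma sum_far: "(\<Sum>v\<in>far r. f (label v)) = k * f c" for f :: "real \<Rightarrow> real"
  using label_far by (simp add: k_def)

lemma sum_V_split: "(\<Sum>v\<in>V. f v) = (\<Sum>v\<in>near. f v) + (\<Sum>v\<in>far r. f v)" for f :: "'a \<Rightarrow> real"
  using far_subset[of r] finite_V by (intro sum.subset_diff) auto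

lemma total_eq: "total = a + m * b + k * c"
  using sum_near[of "\<lambda>y. y"] sum_far[of "\<lambda>y. y"] by (simp add: total_def sum_V_split)

text \<open>With \<open>X\<close> the weight of the side of \<open>v\<close>, the sum is
  \<open>2 * X * (total - X)\<close> and exceeds the bound by
  \<open>2 * (X - c) * (total - X - c)\<close>. The last factor is positive, so equality means
  \<open>X = c\<close>, and then \<open>v\<close> is alone on its side.\<close>

lemma bridge_term:
  assumes uv: "(u, v) \<in> down r"
  defines "T \<equiv> (\<Sum>s\<in>V. \<Sum>t\<in>V. label s * label t * of_bool ((s, t) \<notin> (del u v)\<^sup>*))"
  shows "T \<ge> 2 * c * (total - c)"
    and "T = 2 * c * (total - c) \<Longrightarrow> w \<in> V \<Longrightarrow> (w, v) \<in> (del u v)\<^sup>* \<Longrightarrow> w = v"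
proof -
  define F where "F = {w \<in> V. (w, v) \<in> (del u v)\<^sup>*}"
  define X where "X = sum label F"
  note br = downD[OF uv]
  note V = bridgesD[OF br(1)]
  have "F \<subseteq> V" "finite F"
    using finite_V by (auto simp: F_def)
  have D_sym: "(y, x) \<in> (del u v)\<^sup>*" if "(x, y) \<in> (del u v)\<^sup>*" for x y
    using that by (rule del_rtrancl_sym)
  have D_trans: "(x, z) \<in> (del u v)\<^sup>*" if "(x, y) \<in> (del u v)\<^sup>*" "(y, z) \<in> (del u v)\<^sup>*" for x y z
    using that by (rule rtrancl_trans)
  have near_iff: "w \<in> V - F \<longleftrightarrow> (w, u) \<in> (del u v)\<^sup>*" if "w \<in> V" for w
    using del_reaches_end[OF V(2) that, of v] that V(5) D_trans[OF D_sym, of w u v]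
    unfolding F_def by auto
  have sep: "(s, t) \<notin> (del u v)\<^sup>* \<longleftrightarrow> (s \<in> F \<and> t \<in> V - F \<or> s \<in> V - F \<and> t \<in> F)"
    if st: "s \<in> V" "t \<in> V" for s t
  proof -
    have "(s, t) \<in> (del u v)\<^sup>*" if "s \<in> F" "t \<in> F"
      using that D_trans[OF _ D_sym, of s v t] unfolding F_def by auto
    moreover have "(s, t) \<in> (del u v)\<^sup>*" if "s \<in> V - F" "t \<in> V - F"
      using that near_iff[of s] near_iff[of t] D_trans[OF _ D_sym, of s u t] st by auto
    moreover have "s \<in> F \<longleftrightarrow> t \<in> F" if "(s, t) \<in> (del u v)\<^sup>*"
      using st D_trans[OF that, of v] D_trans[OF D_sym[OF that], of v] unfolding F_def by auto
    ultimately show ?thesis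
      using st by blast
  qed
  have sumVF: "sum label (V - F) = total - X"
    unfolding total_def X_def using \<open>F \<subseteq> V\<close> finite_V by (simp add: sum_diff)
  have restrict: "(\<Sum>s\<in>V. label s * of_bool (s \<in> A)) = sum label A" if "A \<subseteq> V" for A
    using that finite_V by (simp add: of_bool_def if_distrib[of "\<lambda>y. _ * y"] sum.inter_restrict[symmetric]
        Int_absorb1 cong: if_cong)
  have "T = (\<Sum>s\<in>V. \<Sum>t\<in>V. (label s * of_bool (s \<in> F)) * (label t * of_bool (t \<in> V - F))
      + (label s * of_bool (s \<in> V - F)) * (label t * of_bool (t \<in> F)))"
    unfolding T_def using sep by (intro sum.cong refl) (auto simp: of_bool_def)
  also have "\<dots> = X * (total - X) + (total - X) * X"
    using restrict[OF \<open>F \<subseteq> V\<close>] restrict[of "V - F"] sumVF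
    by (simp only: sum.distrib sum_product[symmetric] X_def) simp
  finally have T: "T = 2 * X * (total - X)"
    by (simp add: algebra_simps)
  have "v \<in> F"
    using V by (auto simp: F_def)
  have "v \<in> far r"
    using uv by (force simp: far_def)
  have X: "X = c + sum label (F - {v})"
    unfolding X_def using \<open>v \<in> F\<close> \<open>finite F\<close> label_far[OF \<open>v \<in> far r\<close>] by (simp add: sum.remove)
  \<comment> \<open>A second vertex on the root side: \<open>u\<close> itself or, if
    \<open>u = r\<close>, another neighbour of \<open>r\<close>.\<close>
  have "\<exists>w. w \<noteq> r \<and> w \<in> V - F"
  proof (cases "u = r")
    case False
    then show ?thesis
      using V near_iff[of u] by auto
  next
    case True
    obtain w where w: "(r, w) \<in> E" "w \<noteq> v"
      using r_not_leaf by metis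
    then have "w \<noteq> r" "(w, u) \<in> del u v"
      using E_irrefl E_sym True V by (auto simp: del_def)
    then show ?thesis
      using near_iff[of w] E_V[OF w(1)] by auto
  qed
  then obtain y where y: "y \<noteq> r" "y \<in> V - F"
    by blast
  have "r \<in> V - F"
    using near_iff[OF r_V] br(2) by auto
  then have "sum label {r, y} \<le> sum label (V - F)"
    using y finite_V label_positive by (intro sum_mono2) (auto intro: less_imp_le)
  then have "c < total - X"
    using y label_pos label_less unfolding sumVF by (auto simp: label_def split: if_splits)
  moreover have "T - 2 * c * (total - c) = 2 * (X - c) * (total - X - c)"
    unfolding T by (simp add: algebra_simps)
  moreover have "c \<le> X"
    using X label_positive by (auto intro: sum_nonneg less_imp_le)
  ultimately show "T \<ge> 2 * c * (total - c)"
    by (metis diff_ge_0_iff_ge less_imp_le mult_nonneg_nonneg zero_le_numeral)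
  assume T: "T = 2 * c * (total - c)" and w: "w \<in> V" "(w, v) \<in> (del u v)\<^sup>*"
  then have "X = c"
    using \<open>c < total - X\<close> \<open>T - 2 * c * (total - c) = _\<close> by auto
  then have "sum label (F - {v}) = 0"
    using X by simp
  then have "F - {v} = {}"
    using label_positive \<open>finite F\<close>
    by (metis finite_Diff less_irrefl sum_pos)
  then show "w = v"
    using w by (auto simp: F_def)
qed

section \<open>Pairs of vertices not joined by bridges\<close>

definition far_apart :: "'a \<Rightarrow> 'a \<Rightarrow> real" where
  "far_apart s t = of_bool ((s, t) \<notin> bridges\<^sup>*)"

lemma far_apart_commute: "far_apart s t = far_apart t s"
  using bridges_rtrancl_sym[of s t] bridges_rtrancl_sym[of t s] by (auto simp: far_apart_def)

lemma far_apart_near: "s \<in> near \<Longrightarrow> t \<in> near \<Longrightarrow> far_apart s t = of_bool (s \<noteq> t)"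
  using near_not_bridge_connected[OF r_V, of s t] by (auto simp: far_apart_def)

lemma far_apart_nonneg: "far_apart s t \<ge> 0"
  by (simp add: far_apart_def)

text \<open>At most one near vertex \<open>q0\<close> is joined to \<open>p\<close> by bridges. If
  it is \<open>r\<close>, the sum over the near vertices is \<open>m * b\<close>. Otherwise it could
  fall short when \<open>b > a\<close>; but then \<open>p\<close> is also far apart from
  \<open>p0\<close>, and the extra \<open>c\<close>, taken from the pairs of far ends, makes up for
  the loss strictly.\<close>

lemma far_vertex_term:
  assumes p: "p \<in> far r" and p0: "(r, p0) \<in> bridges"
  defines "g \<equiv> (\<Sum>q\<in>near. label q * far_apart q p) + c * far_apart p p0"
  shows "g \<ge> m * b" and "g = m * b \<Longrightarrow> (r, p) \<in> bridges\<^sup>*"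
proof -
  have off: "g \<ge> a + m * b - label q0 + c * far_apart p p0"
    if "q0 \<in> near" "\<And>q. q \<in> near \<Longrightarrow> q \<noteq> q0 \<Longrightarrow> (q, p) \<notin> bridges\<^sup>*" for q0
  proof -
    have "(\<Sum>q\<in>near - {q0}. label q) = a + m * b - label q0"
      using that(1) finite_V sum_near[of "\<lambda>y. y"] by (simp add: sum_diff1)
    moreover have "(\<Sum>q\<in>near - {q0}. label q) = (\<Sum>q\<in>near - {q0}. label q * far_apart q p)"
      using that(2) by (intro sum.cong refl) (auto simp: far_apart_def)
    moreover have "\<dots> \<le> (\<Sum>q\<in>near. label q * far_apart q p)"
      using finite_V label_positive far_apart_nonneg
      by (intro sum_mono2) (auto intro!: mult_nonneg_nonneg intro: less_imp_le)
    ultimately show ?thesis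
      unfolding g_def by linarith
  qed
  have uniq: "q = q'" if "q \<in> near" "q' \<in> near" "(q, p) \<in> bridges\<^sup>*" "(q', p) \<in> bridges\<^sup>*" for q q'
    using near_not_bridge_connected[OF r_V, of q q'] that(1,2)
      rtrancl_trans[OF that(3) bridges_rtrancl_sym[OF that(4)]] by auto
  have strict: "g > m * b" if np: "(r, p) \<notin> bridges\<^sup>*"
  proof -
    have "far_apart p p0 = 1"
      using np p0 bridges_rtrancl_sym[of p p0] unfolding far_apart_def
      by (auto intro: converse_rtrancl_into_rtrancl)
    obtain q0 where "q0 \<in> near" "\<And>q. q \<in> near \<Longrightarrow> q \<noteq> q0 \<Longrightarrow> (q, p) \<notin> bridges\<^sup>*"
      using uniq r_near np by metis
    moreover have "label q0 < c + a"
      using label_less label_pos \<open>q0 \<in> near\<close> by (auto simp: label_def)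
    ultimately show ?thesis
      using off[of q0] \<open>far_apart p p0 = 1\<close> by auto
  qed
  show "(r, p) \<in> bridges\<^sup>*" if "g = m * b"
    using strict that by fastforce
  show "g \<ge> m * b"
  proof (cases "(r, p) \<in> bridges\<^sup>*")
    case True
    have "c * far_apart p p0 \<ge> 0"
      using label_pos far_apart_nonneg by simp
    then show ?thesis
      using off[OF r_near] uniq[OF _ r_near _ True] by (force simp: label_def)
  next
    case False
    then show ?thesis
      using strict by simp
  qed
qed

text \<open>Near vertices are pairwise far apart, so their pairs give exactly the first two summands
  of \<open>N\<close>. The pairs with a far end give at least \<open>2 * c\<close> times the sum
  over \<open>p\<close> of the quantity bounded in \<open>far_vertex_term\<close>, hence at least
  the third.\<close>

lemma far_apart_term:
  defines "T \<equiv> (\<Sum>s\<in>V. \<Sum>t\<in>V. label s * label t * far_apart s t)"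
    and "N \<equiv> 2 * m * a * b + m * (m - 1) * b\<^sup>2 + 2 * m * k * b * c"
  shows "T \<ge> N" and "T = N \<Longrightarrow> p \<in> far r \<Longrightarrow> (r, p) \<in> bridges\<^sup>*"
proof -
  define NN where "NN = (\<Sum>s\<in>near. \<Sum>t\<in>near. label s * label t * far_apart s t)"
  define NF where "NF = (\<Sum>p\<in>far r. \<Sum>q\<in>near. label q * far_apart q p)"
  define FF where "FF = (\<Sum>p\<in>far r. \<Sum>q\<in>far r. far_apart p q)"
  have "T = NN + (\<Sum>s\<in>near. \<Sum>t\<in>far r. label s * label t * far_apart s t)
      + (\<Sum>s\<in>far r. \<Sum>t\<in>near. label s * label t * far_apart s t)
      + (\<Sum>s\<in>far r. \<Sum>t\<in>far r. label s * label t * far_apart s t)"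
    unfolding T_def NN_def by (simp add: sum_V_split sum.distrib)
  also have "(\<Sum>s\<in>near. \<Sum>t\<in>far r. label s * label t * far_apart s t) = c * NF"
    unfolding NF_def
    by (subst sum.swap) (simp add: sum_distrib_left label_far algebra_simps)
  also have "(\<Sum>s\<in>far r. \<Sum>t\<in>near. label s * label t * far_apart s t) = c * NF"
    unfolding NF_def
    by (simp add: sum_distrib_left label_far algebra_simps far_apart_commute[of _ "_ :: 'a"])
  also have "(\<Sum>s\<in>far r. \<Sum>t\<in>far r. label s * label t * far_apart s t) = c\<^sup>2 * FF"
    unfolding FF_def
    by (simp add: sum_distrib_left label_far power2_eq_square algebra_simps)
  finally have T: "T = NN + 2 * c * NF + c\<^sup>2 * FF"
    by simp
  have "NN = (\<Sum>s\<in>near. \<Sum>t\<in>near. label s * label t - (if s = t then (label s)\<^sup>2 else 0))"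
    unfolding NN_def
    by (intro sum.cong refl) (auto simp: far_apart_near power2_eq_square)
  also have "\<dots> = (\<Sum>s\<in>near. label s) * (\<Sum>t\<in>near. label t) - (\<Sum>s\<in>near. (label s)\<^sup>2)"
    using finite_V by (simp add: sum_subtractf sum_product)
  also have "\<dots> = (a + m * b) * (a + m * b) - (a\<^sup>2 + m * b\<^sup>2)"
    using sum_near[of "\<lambda>y. y"] sum_near[of "\<lambda>y. y\<^sup>2"] by simp
  finally have NN: "NN = 2 * m * a * b + m * (m - 1) * b\<^sup>2"
    by (simp add: power2_eq_square algebra_simps)
  have "T \<ge> N \<and> (T = N \<longrightarrow> (\<forall>p\<in>far r. (r, p) \<in> bridges\<^sup>*))"
  proof (cases "far r = {}")
    case True
    then show ?thesis
      unfolding T NN N_def NF_def FF_def k_def by simp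
  next
    case False
    then have "bridges \<noteq> {}"
      using downD(1) by (force simp: far_def)
    then obtain p0 where p0: "(r, p0) \<in> bridges"
      using r_bridge by blast
    then have "p0 \<in> far r"
      using bridges_down[OF p0 r_V] far_subset[of r] by (force simp: far_def)
    have rows: "(\<Sum>q\<in>far r. far_apart p q) \<ge> far_apart p p0" for p
      using finite_far \<open>p0 \<in> far r\<close> far_apart_nonneg by (intro member_le_sum) auto
    \<comment> \<open>Only the row and the column of \<open>p0\<close> are kept from the symmetric
      double sum; they meet in a zero entry.\<close>
    have "FF = (\<Sum>q\<in>far r. far_apart p0 q) + (\<Sum>p\<in>far r - {p0}. \<Sum>q\<in>far r. far_apart p q)"
      unfolding FF_def using finite_far \<open>p0 \<in> far r\<close> by (intro sum.remove)
    also have "\<dots> \<ge> (\<Sum>q\<in>far r. far_apart q p0) + (\<Sum>p\<in>far r - {p0}. far_apart p p0)"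
      using rows by (intro add_mono sum_mono) (auto simp: far_apart_commute)
    also have "(\<Sum>p\<in>far r - {p0}. far_apart p p0) = (\<Sum>p\<in>far r. far_apart p p0)"
      using finite_far by (intro sum.mono_neutral_left) (auto simp: far_apart_def)
    finally have FF: "FF \<ge> 2 * (\<Sum>p\<in>far r. far_apart p p0)"
      by simp
    define g where "g p = (\<Sum>q\<in>near. label q * far_apart q p) + c * far_apart p p0" for p
    have g: "g p \<ge> m * b" "g p = m * b \<Longrightarrow> (r, p) \<in> bridges\<^sup>*" if "p \<in> far r" for p
      using far_vertex_term[OF that p0] unfolding g_def by auto
    have "sum g (far r) = NF + c * (\<Sum>p\<in>far r. far_apart p p0)"
      unfolding g_def NF_def by (simp add: sum.distrib sum_distrib_left)
    moreover have "c\<^sup>2 * (2 * (\<Sum>p\<in>far r. far_apart p p0)) \<le> c\<^sup>2 * FF"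
      using FF by (intro mult_left_mono) auto
    ultimately have "2 * c * sum g (far r) \<le> 2 * c * NF + c\<^sup>2 * FF"
      by (simp add: power2_eq_square algebra_simps)
    then have "2 * c * (\<Sum>p\<in>far r. g p - m * b) \<le> T - N"
      unfolding T NN N_def by (simp add: sum_subtractf k_def algebra_simps)
    moreover have "(\<Sum>p\<in>far r. g p - m * b) \<ge> 0"
      using g(1) by (intro sum_nonneg) auto
    moreover have "\<forall>p\<in>far r. g p - m * b = 0" if "(\<Sum>p\<in>far r. g p - m * b) = 0"
      using that g(1) finite_far by (subst (asm) sum_nonneg_eq_0_iff) auto
    ultimately show ?thesis
      using g(2) label_pos by (smt (verit) mult_pos_pos mult_nonneg_nonneg)
  qed
  then show "T \<ge> N" and "T = N \<Longrightarrow> p \<in> far r \<Longrightarrow> (r, p) \<in> bridges\<^sup>*"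
    by auto
qed

text \<open>\<open>Q - N\<close> is a sum of three nonnegative defects: that of the bridges, that of
  the pairs not joined by bridges, and the gap between \<open>d\<close> and the bound of
  \<open>walk_length_ge\<close>. If \<open>Q = N\<close>, all three vanish, which determines the
  graph.\<close>

lemma weighted_distance_sum:
  fixes d :: "'a \<Rightarrow> 'a \<Rightarrow> real"
  assumes d: "\<And>s t. s \<in> V \<Longrightarrow> t \<in> V \<Longrightarrow> \<exists>l. (s, t) \<in> E ^^ l \<and> d s t = real l"
  defines "Q \<equiv> (\<Sum>s\<in>V. \<Sum>t\<in>V. d s t * label s * label t)"
    and "N \<equiv> 2 * k * c * (total - c) + 2 * m * a * b + m * (m - 1) * b\<^sup>2 + 2 * m * k * b * c"
  shows weighted_distance_sum_ge: "Q \<ge> N"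
    and weighted_distance_sum_eqD: "Q = N \<Longrightarrow>
      E = {(s, t). s \<in> near \<and> t \<in> near \<and> s \<noteq> t} \<union> {r} \<times> far r \<union> far r \<times> {r}"
proof -
  define L where "L s t = real (card (separating r s t)) + far_apart s t" for s t
  have dL: "L s t \<le> d s t" if "s \<in> V" "t \<in> V" for s t
    using d[OF that] walk_length_ge[OF r_V, of s t] unfolding L_def far_apart_def
    by (metis of_nat_add of_nat_le_iff of_nat_of_bool)
  define QB where "QB u v = (\<Sum>s\<in>V. \<Sum>t\<in>V. label s * label t * of_bool ((s, t) \<notin> (del u v)\<^sup>*))" for u v
  define QF where "QF = (\<Sum>s\<in>V. \<Sum>t\<in>V. label s * label t * far_apart s t)"
  define QD where "QD = (\<Sum>s\<in>V. \<Sum>t\<in>V. (d s t - L s t) * label s * label t)"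
  have cs: "real (card (separating r s t)) = (\<Sum>(u, v)\<in>down r. of_bool ((s, t) \<notin> (del u v)\<^sup>*))" for s t
  proof -
    have "(\<Sum>(u, v)\<in>down r. of_bool ((s, t) \<notin> (del u v)\<^sup>*) :: real) =
        (\<Sum>e\<in>down r. if e \<in> separating r s t then 1 else 0)"
      by (intro sum.cong refl) (auto simp: separating_def)
    also have "\<dots> = real (card (down r \<inter> separating r s t))"
      using finite_down by (simp add: sum.inter_restrict[symmetric])
    also have "down r \<inter> separating r s t = separating r s t"
      by (auto simp: separating_def)
    finally show ?thesis by simp
  qed
  \<comment> \<open>Double counting: bridges separating a given pair become pairs separated by a
    given bridge.\<close>
  have "(\<Sum>s\<in>V. \<Sum>t\<in>V. real (card (separating r s t)) * label s * label t) =
      (\<Sum>s\<in>V. \<Sum>t\<in>V. \<Sum>(u, v)\<in>down r. label s * label t * of_bool ((s, t) \<notin> (del u v)\<^sup>*))"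
    unfolding cs by (simp add: sum_distrib_left sum_distrib_right case_prod_unfold mult_ac)
  also have "\<dots> = (\<Sum>(u, v)\<in>down r. QB u v)"
    unfolding QB_def case_prod_unfold
    by (simp only: sum.swap[of _ "down r" V])
  finally have "(\<Sum>s\<in>V. \<Sum>t\<in>V. real (card (separating r s t)) * label s * label t) =
      (\<Sum>(u, v)\<in>down r. QB u v)" .
  then have "Q = (\<Sum>(u, v)\<in>down r. QB u v) + QF + QD"
    unfolding Q_def QF_def QD_def L_def
    by (simp add: sum_subtractf sum.distrib algebra_simps)
  moreover have "N = (\<Sum>(u, v)\<in>down r. 2 * c * (total - c)) + (2 * m * a * b + m * (m - 1) * b\<^sup>2 + 2 * m * k * b * c)"
    unfolding N_def k_def by (simp add: card_far_eq_down case_prod_unfold)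
  ultimately have QN: "Q - N = (\<Sum>(u, v)\<in>down r. QB u v - 2 * c * (total - c))
      + (QF - (2 * m * a * b + m * (m - 1) * b\<^sup>2 + 2 * m * k * b * c)) + QD"
    by (simp add: case_prod_unfold sum_subtractf)
  have 1: "(\<Sum>(u, v)\<in>down r. QB u v - 2 * c * (total - c)) \<ge> 0"
    using bridge_term(1) by (intro sum_nonneg) (auto simp: QB_def)
  have 2: "QF - (2 * m * a * b + m * (m - 1) * b\<^sup>2 + 2 * m * k * b * c) \<ge> 0"
    using far_apart_term(1) unfolding QF_def by simp
  have 3: "QD \<ge> 0"
    unfolding QD_def using dL label_positive
    by (intro sum_nonneg mult_nonneg_nonneg) (auto intro: less_imp_le)
  show "Q \<ge> N"
    using QN 1 2 3 by linarith
  assume "Q = N"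
  then have e1: "(\<Sum>(u, v)\<in>down r. QB u v - 2 * c * (total - c)) = 0"
    and e2: "QF = 2 * m * a * b + m * (m - 1) * b\<^sup>2 + 2 * m * k * b * c"
    and e3: "QD = 0"
    using QN 1 2 3 by linarith+
  \<comment> \<open>Equality in \<open>bridge_term\<close> for each bridge: it cuts off a single
    vertex, so far ends are leaves.\<close>
  have side: "w = v" if "(u, v) \<in> down r" "w \<in> V" "(w, v) \<in> (del u v)\<^sup>*" for u v w
  proof -
    have "\<forall>e\<in>down r. (case e of (u, v) \<Rightarrow> QB u v - 2 * c * (total - c)) = 0"
      using e1 bridge_term(1) finite_down
      by (subst (asm) sum_nonneg_eq_0_iff) (auto simp: QB_def)
    then have "QB u v = 2 * c * (total - c)"
      using that by auto
    then show ?thesis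
      using bridge_term(2)[OF that(1) _ that(2,3)] unfolding QB_def by simp
  qed
  have leaf: "w = u" if "(u, v) \<in> down r" "(w, v) \<in> E" for u v w
  proof (rule ccontr)
    assume "w \<noteq> u"
    moreover have "v \<noteq> u"
      using bridgesD(4)[OF downD(1)[OF that(1)]] by simp
    ultimately have "(w, v) \<in> del u v"
      using that(2) by (auto simp: del_def)
    then have "w = v"
      using side[OF that(1)] E_V[OF that(2)] by auto
    with that(2) E_irrefl show False by auto
  qed
  \<comment> \<open>A far \<open>u\<close> would be a leaf, with \<open>v\<close> as its only
    neighbour and hence its parent, so that the bridge would point both ways. Being near and joined
    to \<open>r\<close> by bridges, \<open>u\<close> is \<open>r\<close>.\<close>
  have parent: "u = r" if uv: "(u, v) \<in> down r" for u v
  proof -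
    have "u \<notin> far r"
    proof
      assume "u \<in> far r"
      then obtain u' where u': "(u', u) \<in> down r"
        by (auto simp: far_def)
      have "(v, u) \<in> E"
        using bridgesD(1)[OF downD(1)[OF uv]] E_sym by blast
      then have "v = u'"
        using leaf[OF u'] by blast
      then show False
        using u' uv downD(2,3) del_commute by metis
    qed
    moreover have "v \<in> far r"
      using uv by (force simp: far_def)
    then have "(r, v) \<in> bridges\<^sup>*"
      using far_apart_term(2) e2 unfolding QF_def by simp
    then have "(r, u) \<in> bridges\<^sup>*"
      using bridges_sym[OF downD(1)[OF uv]] by auto
    ultimately show "u = r"
      using near_not_bridge_connected[OF r_V, of r u] r_near by auto
  qed
  have leaf': "w = r" if "(w, v) \<in> E" "v \<in> far r" for v w
    using that leaf parent by (force simp: far_def)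
  have far_E: "(r, v) \<in> E" if "v \<in> far r" for v
    using that parent downD(1) bridgesD(1) by (force simp: far_def)
  \<comment> \<open>Bridges cut off only single far ends and separate no two near vertices, so
    \<open>L s t = 1\<close>; as the gap to \<open>d\<close> vanishes, \<open>s\<close> and
    \<open>t\<close> are adjacent.\<close>
  have clique: "(s, t) \<in> E" if st: "s \<in> near" "t \<in> near" "s \<noteq> t" for s t
  proof -
    have "\<forall>s\<in>V. \<forall>t\<in>V. (d s t - L s t) * label s * label t = 0"
    proof (intro ballI)
      fix s t assume "s \<in> V" "t \<in> V"
      have nn: "(d s t - L s t) * label s * label t \<ge> 0" if "s \<in> V" "t \<in> V" for s t
        using dL[OF that] label_positive by (simp add: less_imp_le)
      have "(\<Sum>t\<in>V. (d s t - L s t) * label s * label t) = 0"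
        using e3 nn finite_V \<open>s \<in> V\<close> unfolding QD_def
        by (subst (asm) sum_nonneg_eq_0_iff) (auto intro: sum_nonneg)
      then show "(d s t - L s t) * label s * label t = 0"
        using nn finite_V \<open>s \<in> V\<close> \<open>t \<in> V\<close>
        by (subst (asm) sum_nonneg_eq_0_iff) auto
    qed
    then have "d s t = L s t"
      using st label_positive by (metis DiffD1 eq_iff_diff_eq_0 less_irrefl mult_eq_0_iff)
    moreover have "separating r s t = {}"
    proof -
      have False if "(u, v) \<in> separating r s t" for u v
      proof -
        have uv: "(u, v) \<in> down r" and "(s, t) \<notin> (del u v)\<^sup>*"
          using that by (auto simp: separating_def)
        then have "v \<in> far r" by (force simp: far_def)
        note V = bridgesD[OF downD(1)[OF uv]]
        have "(w, u) \<in> (del u v)\<^sup>*" if "w \<in> near" for w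
          using del_reaches_end[of u w v] side[OF uv, of w] that \<open>v \<in> far r\<close> V by auto
        then have "(s, t) \<in> (del u v)\<^sup>*"
          using st rtrancl_trans[of s u "del u v" t] del_rtrancl_sym[of t u u v] by blast
        then show False
          using \<open>(s, t) \<notin> _\<close> by blast
      qed
      then show ?thesis by auto
    qed
    ultimately have "d s t = 1"
      using far_apart_near[OF st(1,2)] st(3) by (simp add: L_def)
    then show ?thesis
      using d[of s t] st by auto
  qed
  show "E = {(s, t). s \<in> near \<and> t \<in> near \<and> s \<noteq> t} \<union> {r} \<times> far r \<union> far r \<times> {r}"
  proof (intro equalityI subsetI)
    fix e assume "e \<in> E"
    moreover obtain s t where "e = (s, t)" by force
    ultimately show "e \<in> {(s, t). s \<in> near \<and> t \<in> near \<and> s \<noteq> t} \<union> {r} \<times> far r \<union> far r \<times> {r}"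
      using leaf'[of s t] leaf'[of t s] E_sym[of s t] E_V[of s t] E_irrefl[of s] by auto
  next
    fix e assume "e \<in> {(s, t). s \<in> near \<and> t \<in> near \<and> s \<noteq> t} \<union> {r} \<times> far r \<union> far r \<times> {r}"
    then show "e \<in> E"
      using clique far_E E_sym by auto
  qed
qed

end

context fin_conn_graph
begin

text \<open>Take a bridge or, if there is none, any edge. With three or more vertices, one of its
  ends has a further neighbour by connectedness; this end serves as the root.\<close>

lemma suitable_root:
  assumes "card V \<ge> 3"
  obtains r where "r \<in> V" "\<exists>s t. s \<noteq> t \<and> (r, s) \<in> E \<and> (r, t) \<in> E"
    "bridges \<noteq> {} \<Longrightarrow> \<exists>p. (r, p) \<in> bridges"
proof -
  have two: "\<exists>w. w \<noteq> u \<and> w \<noteq> v \<and> ((u, w) \<in> E \<or> (v, w) \<in> E)" if uv: "(u, v) \<in> E" for u v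
  proof (rule ccontr)
    assume no: "\<not> ?thesis"
    have "w \<in> {u, v}" if "(u, w) \<in> E\<^sup>*" for w
      using that
    proof (induction rule: rtrancl_induct)
      case (step y z)
      with no show ?case by blast
    qed auto
    then have "V \<subseteq> {u, v}"
      using E_connected E_V(1)[OF uv] by blast
    then have "card V \<le> card {u, v}"
      by (intro card_mono) auto
    also have "\<dots> \<le> 2"
      by (simp add: card_insert_if)
    finally show False
      using assms by simp
  qed
  have pick: "\<exists>r. r \<in> V \<and> (\<exists>s t. s \<noteq> t \<and> (r, s) \<in> E \<and> (r, t) \<in> E) \<and> (\<exists>p. (r, p) \<in> F)"
    if uv: "(u, v) \<in> F" and F: "\<And>u v. (u, v) \<in> F \<Longrightarrow> (u, v) \<in> E \<and> (v, u) \<in> F" for u v F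
  proof -
    obtain w where w: "w \<noteq> u" "w \<noteq> v" "(u, w) \<in> E \<or> (v, w) \<in> E"
      using two F[OF uv] by blast
    then show ?thesis
      using F[OF uv] F[of v u] E_V by metis
  qed
  show ?thesis
  proof (cases "bridges = {}")
    case True
    obtain u v where "u \<in> V" "v \<in> V" "u \<noteq> v"
      using assms by (metis card_le_Suc0_iff_eq finite_V le_numeral_extra(4) not_less_eq_eq numeral_3_eq_3 nat_le_linear le_SucI)
    then obtain w where "(u, w) \<in> E"
      using E_connected[of u v] by (metis converse_rtranclE)
    then show ?thesis
      using pick[of u w E] E_sym that True by metis
  next
    case False
    then obtain u v where "(u, v) \<in> bridges" by auto
    then show ?thesis
      using pick[of u v bridges] bridgesD(1) bridges_sym that by metis
  qed
qed

end

section \<open>The distance spectral radius\<close>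

text \<open>Turns arc walks into relation powers. The condition on \<open>u\<close> matters for
  \<open>l = 0\<close>, where the power relates every point to itself.\<close>

lemma awalk_length_iff_relpow:
  assumes "wf_digraph (with_proj G)"
  shows "(\<exists>p. pre_digraph.awalk (with_proj G) u p v \<and> length p = l) \<longleftrightarrow>
    u \<in> pverts G \<and> (u, v) \<in> parcs G ^^ l"
proof -
  interpret wf_digraph "with_proj G" by fact
  show ?thesis
  proof (induction l arbitrary: u)
    case 0
    then show ?case
      by (auto simp: awalk_Nil_iff)
  next
    case (Suc l)
    have "(\<exists>p. awalk u p v \<and> length p = Suc l) \<longleftrightarrow>
        (\<exists>w p. (u, w) \<in> parcs G \<and> awalk w p v \<and> length p = l)"
    proof
      assume "\<exists>p. awalk u p v \<and> length p = Suc l"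
      then obtain e p where "awalk u (e # p) v" "length p = l"
        by (metis length_Suc_conv)
      then show "\<exists>w p. (u, w) \<in> parcs G \<and> awalk w p v \<and> length p = l"
        by (cases e) (auto simp: awalk_Cons_iff)
    next
      assume "\<exists>w p. (u, w) \<in> parcs G \<and> awalk w p v \<and> length p = l"
      then obtain w p where "(u, w) \<in> parcs G" "awalk w p v" "length p = l"
        by blast
      then show "\<exists>p. awalk u p v \<and> length p = Suc l"
        by (intro exI[of _ "(u, w) # p"]) (auto simp: awalk_Cons_iff)
    qed
    also have "\<dots> \<longleftrightarrow> (\<exists>w. (u, w) \<in> parcs G \<and> (w, v) \<in> parcs G ^^ l)"
      using Suc.IH wellformed by auto
    also have "\<dots> \<longleftrightarrow> u \<in> pverts G \<and> (u, v) \<in> parcs G ^^ Suc l"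
      using wellformed(1) relpow_Suc_D2[of u v l "parcs G"] relpow_Suc_I2[of u _ "parcs G" v l]
      by (auto simp del: relpow.simps)
    finally show ?case .
  qed
qed

text \<open>With unit weights the cost of a walk is its length, and as a walk exists, the infimum is
  attained by a shortest one.\<close>

lemma graph_dist_relpow:
  assumes "wf_digraph (with_proj G)" "u \<in> pverts G" "(u, v) \<in> (parcs G)\<^sup>*"
  shows "graph_dist G u v = real (LEAST l. (u, v) \<in> parcs G ^^ l)"
proof -
  interpret wf_digraph "with_proj G" by fact
  let ?l = "LEAST l. (u, v) \<in> parcs G ^^ l"
  have cost: "awalk_cost (\<lambda>_. 1) p = real (length p)" for p
    by (simp add: awalk_cost_def sum_list_triv)
  note walk = awalk_length_iff_relpow[OF assms(1), of u v]
  have "(u, v) \<in> parcs G ^^ ?l"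
    using assms(3) by (auto simp: rtrancl_power intro: LeastI)
  then obtain p where "awalk u p v" "length p = ?l"
    using walk assms(2) by blast
  then have "\<mu> (\<lambda>_. 1) u v \<le> ereal (real ?l)"
    using min_cost_le_walk_cost[of u p v] cost by metis
  moreover have "ereal (real ?l) \<le> \<mu> (\<lambda>_. 1) u v"
    unfolding \<mu>_def
  proof (rule INF_greatest)
    fix q assume "q \<in> {q. awalk u q v}"
    then have "?l \<le> length q"
      using walk by (auto intro: Least_le)
    then show "ereal (real ?l) \<le> ereal (awalk_cost (\<lambda>_. 1) q)"
      by (simp add: cost)
  qed
  ultimately have "\<mu> (\<lambda>_. 1) u v = ereal (real ?l)"
    by simp
  then show ?thesis
    by (simp add: graph_dist_def)
qed

lemma connected_iff_rtrancl:
  assumes "parcs G \<subseteq> pverts G \<times> pverts G" "sym (parcs G)"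
  shows "Digraph_Component.connected (with_proj G) \<longleftrightarrow>
    pverts G \<noteq> {} \<and> (\<forall>u\<in>pverts G. \<forall>v\<in>pverts G. (u, v) \<in> (parcs G)\<^sup>*)"
proof -
  have "parcs (mk_symmetric (with_proj G)) = parcs G"
    using assms(2) by (force simp: parcs_mk_symmetric sym_def)
  moreover have "(u, v) \<in> rtrancl_on (pverts G) (parcs G)"
    if "u \<in> pverts G" "(u, v) \<in> (parcs G)\<^sup>*" for u v
    using that(2,1)
  proof (induction rule: rtrancl_induct)
    case (step y z)
    then show ?case
      using assms(1) by (auto intro: rtrancl_on_into_rtrancl_on)
  qed auto
  ultimately have "(u, v) \<in> rtrancl_on (pverts G) (parcs (mk_symmetric (with_proj G)))
      \<longleftrightarrow> (u, v) \<in> (parcs G)\<^sup>*" if "u \<in> pverts G" for u v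
    using that by (auto dest: rtrancl_on_rtranclI)
  then show ?thesis
    unfolding Digraph_Component.connected_def strongly_connected_def reachable_def by simp
qed

text \<open>\<open>n > 0\<close> is stated separately because connectedness demands a vertex,
  whereas the locale admits the empty graph.\<close>

lemma connected_graph_iff:
  "connected_graph n G \<longleftrightarrow> n > 0 \<and> pverts G = {0..<n} \<and> fin_conn_graph {0..<n} (parcs G)"
proof
  assume G: "connected_graph n G"
  then interpret G: pair_graph G
    by (simp add: connected_graph_def)
  have V: "pverts G = {0..<n}"
    using G by (simp add: connected_graph_def)
  have E: "parcs G \<subseteq> pverts G \<times> pverts G"
    using G.in_arcsD1 G.in_arcsD2 by auto
  have sym: "sym (parcs G)"
    using G.arcs_symmetric by (auto intro: symI)
  have conn: "n > 0" "\<forall>u\<in>pverts G. \<forall>v\<in>pverts G. (u, v) \<in> (parcs G)\<^sup>*"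
    using G V unfolding connected_graph_def connected_iff_rtrancl[OF E sym] by auto
  have "fin_conn_graph {0..<n} (parcs G)"
  proof
    show "(v, u) \<in> parcs G" if "(u, v) \<in> parcs G" for u v
      using that G.arcs_symmetric by auto
    show "(v, v) \<notin> parcs G" for v
      using G.no_loops' by auto
  qed (use E V conn in auto)
  with V conn show "n > 0 \<and> pverts G = {0..<n} \<and> fin_conn_graph {0..<n} (parcs G)"
    by simp
next
  assume *: "n > 0 \<and> pverts G = {0..<n} \<and> fin_conn_graph {0..<n} (parcs G)"
  then interpret fin_conn_graph "{0..<n}" "parcs G"
    by simp
  have sym: "sym (parcs G)"
    using E_sym by (auto intro: symI)
  have E: "parcs G \<subseteq> pverts G \<times> pverts G"
    using * E_in_V by simp
  then have "finite (parcs G)"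
    using * finite_subset by fastforce
  then have "pair_graph G"
    using * E_irrefl E sym
    by unfold_locales (auto simp: symmetric_def)
  moreover have "Digraph_Component.connected (with_proj G)"
    unfolding connected_iff_rtrancl[OF E sym] using * E_connected by auto
  ultimately show "connected_graph n G"
    using * by (simp add: connected_graph_def)
qed

text \<open>If the ends of a deleted edge remain joined, every walk can be rerouted; so deletion
  disconnects the graph only by separating these ends.\<close>

lemma cut_edges_eq_bridges:
  assumes "fin_conn_graph (pverts G) (parcs G)"
  shows "cut_edges G = {{u, v} | u v. (u, v) \<in> fin_conn_graph.bridges (parcs G)}"
proof -
  interpret fin_conn_graph "pverts G" "parcs G" by fact
  have "\<not> Digraph_Component.connected (with_proj (delete_edge G u v)) \<longleftrightarrow> (u, v) \<in> bridges"
    if uv: "(u, v) \<in> parcs G" for u v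
  proof -
    have sub: "parcs (delete_edge G u v) = del u v" "pverts (delete_edge G u v) = pverts G"
      by (auto simp: delete_edge_def del_def)
    have "sym (del u v)"
      unfolding del_def using E_sym by (auto intro: symI)
    then have "Digraph_Component.connected (with_proj (delete_edge G u v)) \<longleftrightarrow>
        (\<forall>s\<in>pverts G. \<forall>t\<in>pverts G. (s, t) \<in> (del u v)\<^sup>*)"
      using connected_iff_rtrancl[of "delete_edge G u v"] del_subset[of u v] E_in_V E_V[OF uv]
      unfolding sub by auto
    also have "\<dots> \<longleftrightarrow> (u, v) \<in> (del u v)\<^sup>*"
    proof
      assume "(u, v) \<in> (del u v)\<^sup>*"
      then have "parcs G \<subseteq> (del u v)\<^sup>*"
        using del_rtrancl_sym[of u v u v] by (intro subrelI) (auto simp: del_def intro: r_into_rtrancl)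
      then have "(parcs G)\<^sup>* \<subseteq> (del u v)\<^sup>*"
        by (metis rtrancl_idemp rtrancl_mono)
      then show "\<forall>s\<in>pverts G. \<forall>t\<in>pverts G. (s, t) \<in> (del u v)\<^sup>*"
        using E_connected by blast
    qed (use E_V[OF uv] in auto)
    finally show ?thesis
      using uv by (auto simp: bridges_def)
  qed
  then show ?thesis
    unfolding cut_edges_def using bridgesD(1) by blast
qed

section \<open>Distances and the Perron vector of a connected graph\<close>

lemma graph_dist_props:
  assumes "fin_conn_graph (pverts G) (parcs G)" "u \<in> pverts G" "v \<in> pverts G"
  shows "\<exists>l. (u, v) \<in> parcs G ^^ l \<and> graph_dist G u v = real l"
    and "graph_dist G u v = graph_dist G v u"
    and "graph_dist G u u = 0"
    and "u \<noteq> v \<Longrightarrow> graph_dist G u v > 0"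
proof -
  interpret fin_conn_graph "pverts G" "parcs G" by fact
  have wf: "wf_digraph (with_proj G)"
    using E_V by unfold_locales auto
  note dist = graph_dist_relpow[OF wf _ E_connected]
  have walk: "(u, v) \<in> parcs G ^^ (LEAST l. (u, v) \<in> parcs G ^^ l)"
    using E_connected[OF assms(2,3)] by (auto simp: rtrancl_power intro: LeastI)
  then show "\<exists>l. (u, v) \<in> parcs G ^^ l \<and> graph_dist G u v = real l"
    using dist assms(2,3) by blast
  have "(t, s) \<in> parcs G ^^ l" if "(s, t) \<in> parcs G ^^ l" for s t l
    using that
  proof (induction l arbitrary: t)
    case (Suc l)
    then obtain w where "(s, w) \<in> parcs G ^^ l" "(w, t) \<in> parcs G"
      by auto
    with Suc.IH E_sym show ?case
      by (blast intro: relpow_Suc_I2)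
  qed auto
  then have "(u, v) \<in> parcs G ^^ l \<longleftrightarrow> (v, u) \<in> parcs G ^^ l" for l
    by blast
  then show "graph_dist G u v = graph_dist G v u"
    using dist assms(2,3) by simp
  have "(LEAST l. (u, u) \<in> parcs G ^^ l) = 0"
    by (rule Least_equality) auto
  then show "graph_dist G u u = 0"
    using dist[OF assms(2) assms(2,2)] by simp
  show "u \<noteq> v \<Longrightarrow> graph_dist G u v > 0"
    using dist[OF assms(2) assms(2,3)] walk by (auto intro!: gr0I)
qed

lemma distance_matrix_perron:
  assumes "connected_graph n G" "n \<ge> 3"
  obtains x where
    "\<And>i. i < n \<Longrightarrow> x i > 0"
    "\<And>i. i < n \<Longrightarrow> (\<Sum>j<n. graph_dist G i j * x j) = distance_spectral_radius G * x i"
    "\<And>y. quad_form n (graph_dist G) y \<le> distance_spectral_radius G * sq_norm_upto n y"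
proof -
  have G: "pverts G = {0..<n}" "fin_conn_graph (pverts G) (parcs G)"
    using assms(1) by (auto simp: connected_graph_iff)
  have eq: "distance_spectral_radius G =
      (THE l. is_arg_max abs (eigenvalue (Matrix.mat n n (\<lambda>(i, j). graph_dist G i j))) l)"
    unfolding distance_spectral_radius_def distance_matrix_def by (simp add: G(1))
  have dist: "graph_dist G i j = graph_dist G j i" "i \<noteq> j \<Longrightarrow> graph_dist G i j > 0" "graph_dist G i i = 0"
    if "i < n" "j < n" for i j
    using graph_dist_props(2-4)[OF G(2), of i j] that by (auto simp: G(1))
  show ?thesis
  proof (rule perron_largest_eigenvalue[OF assms(2), of "graph_dist G"])
    fix l x
    assume "(THE l. is_arg_max abs (eigenvalue (Matrix.mat n n (\<lambda>(i, j). graph_dist G i j))) l) = l"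
      "\<And>i. i < n \<Longrightarrow> x i > 0"
      "\<And>i. i < n \<Longrightarrow> (\<Sum>j<n. graph_dist G i j * x j) = l * x i"
      "\<And>y. quad_form n (graph_dist G) y \<le> l * sq_norm_upto n y"
    then show ?thesis
      using that[of x] unfolding eq by blast
  qed (fact dist(1), fact dist(2), use dist(3) in auto)
qed

section \<open>The graph \<open>K\<^sub>n\<^sup>k\<close>: cut edges, distances, Perron
  vector\<close>

abbreviation (input) K_arcs :: "nat \<Rightarrow> nat \<Rightarrow> (nat \<times> nat) set" where
  "K_arcs n k \<equiv> parcs (K_pendant n k)"

lemma K_arcs_iff:
  "(u, v) \<in> K_arcs n k \<longleftrightarrow> u < n - k \<and> v < n - k \<and> u \<noteq> v \<or>
    u = 0 \<and> n - k \<le> v \<and> v < n \<or> v = 0 \<and> n - k \<le> u \<and> u < n"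
  by (auto simp: K_pendant_def)

lemma K_pendant_fin_conn_graph:
  assumes "k < n"
  shows "fin_conn_graph {0..<n} (K_arcs n k)"
proof
  have to0: "(u, 0) \<in> (K_arcs n k)\<^sup>*" "(0, u) \<in> (K_arcs n k)\<^sup>*" if "u < n" for u
    using that assms by (cases "u = 0"; force simp: K_arcs_iff)+
  show "(u, v) \<in> (K_arcs n k)\<^sup>*" if "u \<in> {0..<n}" "v \<in> {0..<n}" for u v
    using to0(1)[of u] to0(2)[of v] that by (auto intro: rtrancl_trans)
qed (use assms in \<open>auto simp: K_arcs_iff\<close>)

lemma connected_graph_K_pendant:
  assumes "k < n"
  shows "connected_graph n (K_pendant n k)"
  unfolding connected_graph_iff using K_pendant_fin_conn_graph[OF assms] assms
  by (auto simp: K_pendant_def)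

text \<open>The pendant edges are bridges, and an edge of a clique on at least three vertices lies
  in a triangle. For \<open>n - k = 2\<close> the single clique edge would be one more cut
  edge.\<close>

lemma card_cut_edges_K_pendant:
  assumes "k < n" "n - k \<noteq> 2"
  shows "card (cut_edges (K_pendant n k)) = k"
proof -
  interpret fin_conn_graph "{0..<n}" "K_arcs n k"
    by (rule K_pendant_fin_conn_graph[OF assms(1)])
  have V: "pverts (K_pendant n k) = {0..<n}"
    by (simp add: K_pendant_def)
  have pendant: "(0, v) \<in> bridges" if v: "n - k \<le> v" "v < n" for v
  proof -
    have "v \<noteq> 0"
      using v assms by auto
    moreover have "(z, v) \<notin> del 0 v" for z
      using v assms by (auto simp: del_def K_arcs_iff)
    ultimately have "(0, v) \<notin> (del 0 v)\<^sup>*"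
      by (metis rtranclE)
    then show ?thesis
      using v by (simp add: bridges_def K_arcs_iff)
  qed
  have clique: "(u, v) \<notin> bridges" if uv: "u < n - k" "v < n - k" "u \<noteq> v" for u v
  proof -
    have "n - k \<ge> 3"
      using uv assms by linarith
    define w :: nat where "w = (if u \<noteq> 0 \<and> v \<noteq> 0 then 0 else if u \<noteq> 1 \<and> v \<noteq> 1 then 1 else 2)"
    have "w < n - k" "w \<noteq> u" "w \<noteq> v"
      using \<open>n - k \<ge> 3\<close> uv(3) by (auto simp: w_def)
    then have "(u, w) \<in> del u v" "(w, v) \<in> del u v"
      using uv by (auto simp: del_def K_arcs_iff)
    then have "(u, v) \<in> (del u v)\<^sup>*"
      by auto
    then show ?thesis
      by (simp add: bridges_def)
  qed
  have "(u, v) \<in> bridges \<longleftrightarrow> u = 0 \<and> n - k \<le> v \<and> v < n \<or> v = 0 \<and> n - k \<le> u \<and> u < n" for u v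
    using pendant bridges_sym[OF pendant] clique bridgesD(1)[of u v] unfolding K_arcs_iff by blast
  then have "{{u, v} | u v. (u, v) \<in> bridges} = (\<lambda>v. {0, v}) ` {n - k..<n}"
    by (intro equalityI subsetI) (force simp: insert_commute)+
  moreover have "inj_on (\<lambda>v. {0, v}) {n - k..<n}"
    by (auto simp: inj_on_def doubleton_eq_iff)
  ultimately have "card {{u, v} | u v. (u, v) \<in> bridges} = k"
    using assms by (simp add: card_image)
  then show ?thesis
    using cut_edges_eq_bridges[of "K_pendant n k"] fin_conn_graph_axioms by (simp add: V)
qed

lemma graph_dist_K_pendant:
  assumes "k < n" "u < n" "v < n"
  shows "graph_dist (K_pendant n k) u v = (if u = v then 0 else if (u, v) \<in> K_arcs n k then 1 else 2)"
proof -
  interpret fin_conn_graph "{0..<n}" "K_arcs n k"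
    by (rule K_pendant_fin_conn_graph[OF assms(1)])
  have V: "pverts (K_pendant n k) = {0..<n}"
    by (simp add: K_pendant_def)
  have wf: "wf_digraph (with_proj (K_pendant n k))"
    using E_V by unfold_locales (auto simp: V)
  have "(LEAST l. (u, v) \<in> K_arcs n k ^^ l) = (if u = v then 0 else if (u, v) \<in> K_arcs n k then 1 else 2)"
  proof (rule Least_equality)
    have "(u, 0) \<in> K_arcs n k" "(0, v) \<in> K_arcs n k" if "u \<noteq> v" "(u, v) \<notin> K_arcs n k"
      using that assms by (auto simp: K_arcs_iff)
    then show "(u, v) \<in> K_arcs n k ^^ (if u = v then 0 else if (u, v) \<in> K_arcs n k then 1 else 2)"
      by (auto simp: numeral_2_eq_2)
  next
    fix l assume l: "(u, v) \<in> K_arcs n k ^^ l"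
    then have "l = 0 \<Longrightarrow> u = v" "l = 1 \<Longrightarrow> (u, v) \<in> K_arcs n k"
      by auto
    then show "(if u = v then 0 else if (u, v) \<in> K_arcs n k then 1 else 2) \<le> l"
      by (cases "l = 0"; cases "l = 1") auto
  qed
  then show ?thesis
    using graph_dist_relpow[OF wf _ E_connected, of u v] assms by (simp add: V)
qed

text \<open>If \<open>m = 0\<close>, no vertex has the value \<open>b\<close>, and \<open>b = c\<close> is chosen to satisfy the two strict inequalities.\<close>

lemma K_pendant_perron:
  assumes "k < n" "n \<ge> 3"
  defines "m \<equiv> real (n - k - 1)"
  obtains a b c :: real where "a > 0" "b > 0" "c > 0" "c < a + b" "b < c + a"
    "distance_spectral_radius (K_pendant n k) * (a\<^sup>2 + m * b\<^sup>2 + real k * c\<^sup>2) =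
      2 * real k * c * (a + m * b + real k * c - c) + 2 * m * a * b + m * (m - 1) * b\<^sup>2 + 2 * m * real k * b * c"
proof -
  let ?K = "K_pendant n k"
  define l where "l = distance_spectral_radius ?K"
  obtain y where y: "\<And>i. i < n \<Longrightarrow> y i > 0"
    "\<And>i. i < n \<Longrightarrow> (\<Sum>j<n. graph_dist ?K i j * y j) = l * y i"
    unfolding l_def using distance_matrix_perron[OF connected_graph_K_pendant[OF assms(1)] assms(2)] by metis
  define a where "a = y 0"
  \<comment> \<open>Each row of the eigenvalue equation involves only \<open>C\<close>,
    \<open>P\<close>, \<open>a\<close> and the entry itself, so entries of vertices of the same kind
    agree.\<close>
  define C where "C = (\<Sum>j<n - k. y j)"
  define P where "P = (\<Sum>j=n-k..<n. y j)"
  have split: "(\<Sum>j<n. f j) = (\<Sum>j<n - k. f j) + (\<Sum>j=n-k..<n. f j)" for f :: "nat \<Rightarrow> real"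
    using sum.atLeastLessThan_concat[of 0 "n - k" n f] by (simp add: lessThan_atLeast0)
  have CP: "(\<Sum>j<n. y j) = C + P"
    unfolding C_def P_def by (rule split)
  have k0: "0 < n - k"
    using assms by simp
  have d: "graph_dist ?K i j = (if i = j then 0 else if (i, j) \<in> K_arcs n k then 1 else 2)" if "i < n" "j < n" for i j
    using graph_dist_K_pendant[OF assms(1)] that by simp
  have e0: "l * a = C + P - a"
  proof -
    have "l * a = (\<Sum>j<n. y j - (if j = 0 then y 0 else 0))"
      unfolding a_def y(2)[of 0, symmetric, OF order.strict_trans2[OF k0 diff_le_self]]
      using assms by (intro sum.cong refl) (auto simp: d K_arcs_iff)
    then show ?thesis
      using assms by (simp add: sum_subtractf CP a_def)
  qed
  have eC: "l * y i = C - y i + 2 * P" if i: "i < n - k" "i \<noteq> 0" for i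
  proof -
    have "l * y i = (\<Sum>j<n - k. graph_dist ?K i j * y j) + (\<Sum>j=n-k..<n. graph_dist ?K i j * y j)"
      using y(2)[of i] i split[of "\<lambda>j. graph_dist ?K i j * y j"] by simp
    also have "(\<Sum>j<n - k. graph_dist ?K i j * y j) = (\<Sum>j<n - k. y j - (if j = i then y i else 0))"
      using i assms by (intro sum.cong refl) (auto simp: d K_arcs_iff)
    also have "(\<Sum>j=n-k..<n. graph_dist ?K i j * y j) = (\<Sum>j=n-k..<n. 2 * y j)"
      using i assms by (intro sum.cong refl) (auto simp: d K_arcs_iff)
    finally show ?thesis
      using i by (simp add: sum_subtractf C_def P_def sum_distrib_left)
  qed
  have eP: "l * y i = 2 * (C + P) - a - 2 * y i" if i: "n - k \<le> i" "i < n" for i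
  proof -
    have "l * y i = (\<Sum>j<n. 2 * y j - (if j = 0 then y 0 else 0) - (if j = i then 2 * y i else 0))"
      unfolding y(2)[OF i(2), symmetric]
      using i k0 assms by (intro sum.cong refl) (auto simp: d K_arcs_iff)
    also have "\<dots> = 2 * (C + P) - a - 2 * y i"
      using i by (simp add: sum_subtractf CP a_def sum_distrib_left[symmetric])
    finally show ?thesis .
  qed
  have "a > 0"
    using y(1) assms by (simp add: a_def)
  have "C + P > a"
  proof -
    have "sum y {0, 1} \<le> sum y {..<n}"
      using assms y(1) by (intro sum_mono2) (auto intro: less_imp_le)
    then show ?thesis
      using y(1)[of 1] assms CP by (simp add: a_def)
  qed
  then have "l > 0"
    using e0 \<open>a > 0\<close> by (metis diff_gt_0_iff_gt zero_less_mult_pos2)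
  have "{..<n - k} \<noteq> {}"
    using k0 by (simp add: lessThan_empty_iff)
  then have "C > 0" "P \<ge> 0"
    unfolding C_def P_def using y(1)
    by (auto intro!: sum_pos sum_nonneg simp: less_imp_le)
  \<comment> \<open>The solutions of the rows for the entry. As explicit quotients, \<open>b\<close>
    and \<open>c\<close> are positive even if there is no vertex of their kind.\<close>
  define b where "b = (C + 2 * P) / (l + 1)"
  define c where "c = (2 * (C + P) - a) / (l + 2)"
  have "y i = b" if "i < n - k" "i \<noteq> 0" for i
    using eC[OF that] \<open>l > 0\<close> by (simp add: b_def field_simps)
  moreover have "C = a + (\<Sum>j\<in>{..<n - k} - {0}. y j)"
    unfolding C_def a_def using k0 by (intro sum.remove) auto
  moreover have "(\<Sum>j\<in>{..<n - k} - {0}. y j) = (\<Sum>j\<in>{..<n - k} - {0}. b)"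
    using calculation(1) by (intro sum.cong) auto
  ultimately have C: "C = a + m * b"
    using k0 by (simp add: m_def)
  have "y i = c" if "n - k \<le> i" "i < n" for i
    using eP[OF that] \<open>l > 0\<close> by (simp add: c_def field_simps)
  then have P: "P = real k * c"
    unfolding P_def using assms by simp
  have "b > 0" "c > 0"
    using \<open>l > 0\<close> \<open>C > 0\<close> \<open>P \<ge> 0\<close> \<open>C + P > a\<close> \<open>a > 0\<close> by (auto simp: b_def c_def)
  have eb: "l * b = C + 2 * P - b"
    using \<open>l > 0\<close> by (simp add: b_def field_simps)
  have ec: "l * c = 2 * (C + P) - a - 2 * c"
    using \<open>l > 0\<close> by (simp add: c_def field_simps)
  have "l * (a\<^sup>2 + m * b\<^sup>2 + real k * c\<^sup>2) = a * (l * a) + m * b * (l * b) + real k * c * (l * c)"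
    by (simp add: power2_eq_square algebra_simps)
  also have "\<dots> = 2 * real k * c * (a + m * b + real k * c - c) + 2 * m * a * b + m * (m - 1) * b\<^sup>2 + 2 * m * real k * b * c"
    unfolding e0 eb ec unfolding C P by (simp add: power2_eq_square algebra_simps)
  finally have id: "l * (a\<^sup>2 + m * b\<^sup>2 + real k * c\<^sup>2) = \<dots>" .
  show ?thesis
  proof (cases "n - k - 1 = 0")
    case True
    then show ?thesis
      using that[of a c c] id \<open>a > 0\<close> \<open>c > 0\<close> by (simp add: m_def l_def)
  next
    case False
    then have "m \<ge> 1"
      by (simp add: m_def)
    \<comment> \<open>The difference of the rows for \<open>c\<close> and \<open>b\<close>. It
      yields \<open>b \<le> c\<close>, hence \<open>b < c + a\<close>; a combination of all three
      rows then gives \<open>c < a + b\<close>.\<close>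
    have "(l + 2) * (c - b) = (m - 1) * b"
      using eb ec unfolding C P by (simp add: algebra_simps)
    then have "b \<le> c"
      using \<open>m \<ge> 1\<close> \<open>b > 0\<close> \<open>l > 0\<close>
      by (metis add_pos_pos diff_ge_0_iff_ge less_imp_le mult_nonneg_nonneg zero_le_mult_iff zero_less_numeral not_less)
    have "l * (a + b - c) = real k * c + (c - b) + c"
      using e0 eb ec unfolding C P by (simp add: algebra_simps)
    moreover have "real k * c \<ge> 0"
      using \<open>c > 0\<close> by simp
    ultimately have "l * (a + b - c) > 0"
      using \<open>b \<le> c\<close> \<open>c > 0\<close> by linarith
    then have "c < a + b"
      using \<open>l > 0\<close> by (simp add: zero_less_mult_iff)
    then show ?thesis
      using that[of a b c] id \<open>a > 0\<close> \<open>b > 0\<close> \<open>c > 0\<close> \<open>b \<le> c\<close> by (simp add: l_def)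
  qed
qed

text \<open>Adjacency depends only on the kinds of the two vertices, so it suffices to match
  \<open>r\<close> with \<open>0\<close>, \<open>F\<close> with the pendant vertices and the rest
  with the rest of the clique.\<close>

lemma digraph_iso_K_pendant:
  assumes V: "pverts G = {0..<n}"
    and wf: "wf_digraph (with_proj G)"
    and far: "r \<in> {0..<n}" "F \<subseteq> {0..<n} - {r}" "card F = k"
    and E: "parcs G = {(s, t). s \<in> {0..<n} - F \<and> t \<in> {0..<n} - F \<and> s \<noteq> t} \<union> {r} \<times> F \<union> F \<times> {r}"
  shows "digraph_iso (with_proj G) (with_proj (K_pendant n k))"
proof -
  let ?N = "{0..<n} - F - {r}"
  have "finite F"
    using far by (meson finite_Diff finite_atLeastLessThan finite_subset)
  have "card (insert r F) \<le> card {0..<n}"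
    using far by (intro card_mono) auto
  then have "k < n"
    using far \<open>finite F\<close> by (simp add: card_insert_if subset_Diff_insert)
  have "?N = {0..<n} - insert r F"
    by auto
  then have "card ?N = n - Suc k"
    using far \<open>finite F\<close> by (simp add: card_Diff_subset card_insert_if subset_Diff_insert)
  then obtain g where g: "bij_betw g ?N {1..<n - k}"
    using finite_same_card_bij[of ?N "{1..<n - k}"] by auto
  obtain h where h: "bij_betw h F {n - k..<n}"
    using finite_same_card_bij[of F "{n - k..<n}"] \<open>finite F\<close> far \<open>k < n\<close> by auto
  define f where "f v = (if v = r then 0 else if v \<in> F then h v else g v)" for v
  have fr: "f r = 0"
    by (simp add: f_def)
  have fF: "bij_betw f F {n - k..<n}"
    using h far by (subst bij_betw_cong[of _ _ h]) (auto simp: f_def)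
  have "bij_betw f ?N {1..<n - k}"
    using g by (subst bij_betw_cong[of _ _ g]) (auto simp: f_def)
  moreover have "bij_betw f {r} {0}"
    by (simp add: f_def bij_betw_def)
  ultimately have "bij_betw f (?N \<union> {r}) ({1..<n - k} \<union> {0})"
    by (intro bij_betw_combine) auto
  moreover have "?N \<union> {r} = {0..<n} - F" "{1..<n - k} \<union> {0} = {0..<n - k}"
    using far \<open>k < n\<close> by auto
  ultimately have fN: "bij_betw f ({0..<n} - F) {0..<n - k}"
    by simp
  have "bij_betw f (({0..<n} - F) \<union> F) ({0..<n - k} \<union> {n - k..<n})"
    using fN fF by (intro bij_betw_combine) auto
  moreover have "({0..<n} - F) \<union> F = {0..<n}" "{0..<n - k} \<union> {n - k..<n} = {0..<n}"
    using far by auto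
  ultimately have fV: "bij_betw f {0..<n} {0..<n}"
    by simp
  have inj: "f s = f t \<longleftrightarrow> s = t" if "s \<in> {0..<n}" "t \<in> {0..<n}" for s t
    using fV that by (auto simp: bij_betw_def inj_on_def)
  have imN: "f ` ({0..<n} - F) = {0..<n - k}" and imF: "f ` F = {n - k..<n}"
    using fN fF by (auto simp: bij_betw_def)
  let ?ff = "map_prod f f"
  have "?ff ` parcs G = parcs (K_pendant n k)"
  proof -
    have "?ff ` {(s, t). s \<in> {0..<n} - F \<and> t \<in> {0..<n} - F \<and> s \<noteq> t} = {(u, v). u < n - k \<and> v < n - k \<and> u \<noteq> v}"
      (is "?ff ` ?A = ?B")
    proof (intro equalityI subsetI)
      fix e assume "e \<in> ?ff ` ?A"
      then obtain s t where st: "e = (f s, f t)" "s \<in> {0..<n} - F" "t \<in> {0..<n} - F" "s \<noteq> t"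
        by auto
      then have "f s \<in> f ` ({0..<n} - F)" "f t \<in> f ` ({0..<n} - F)" "f s \<noteq> f t"
        using inj[of s t] by auto
      then show "e \<in> ?B"
        unfolding imN st(1) by simp
    next
      fix e assume "e \<in> ?B"
      then obtain u v where uv: "e = (u, v)" "u \<in> f ` ({0..<n} - F)" "v \<in> f ` ({0..<n} - F)" "u \<noteq> v"
        unfolding imN by auto
      then obtain s t where "u = f s" "v = f t" "s \<in> {0..<n} - F" "t \<in> {0..<n} - F"
        by blast
      then show "e \<in> ?ff ` ?A"
        using uv by (intro image_eqI[of _ _ "(s, t)"]) auto
    qed
    moreover have prod: "?ff ` (A \<times> B) = f ` A \<times> f ` B" for A B
      by force
    moreover have "?ff ` ({r} \<times> F) = {0} \<times> {n - k..<n}" "?ff ` (F \<times> {r}) = {n - k..<n} \<times> {0}"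
      using imF fr prod by auto
    ultimately show ?thesis
      unfolding E by (simp add: image_Un K_pendant_def)
  qed
  moreover have "inj_on ?ff (parcs G)"
  proof (rule inj_on_subset)
    show "inj_on ?ff ({0..<n} \<times> {0..<n})"
      using inj by (auto simp: inj_on_def)
    show "parcs G \<subseteq> {0..<n} \<times> {0..<n}"
      using far unfolding E by auto
  qed
  ultimately show ?thesis
    unfolding digraph_iso_def
    using fV V wf
    by (intro exI[of _ "\<lparr>iso_verts = f, iso_arcs = ?ff, iso_head = snd, iso_tail = fst\<rparr>"])
      (auto simp: pre_digraph.digraph_isomorphism_def app_iso_def with_proj_def bij_betw_def K_pendant_def)
qed

text \<open>The form of \<open>G\<close> at \<open>label\<close> is at most the spectral radius of
  \<open>G\<close> times the squared norm, and by \<open>weighted_distance_sum\<close> at least that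
  of \<open>K\<^sub>n\<^sup>k\<close> times the same norm. Equality of the radii forces equality in
  the lower bound.\<close>

lemma distance_spectral_radius_ge_K_pendant:
  assumes "n \<ge> 4" "G \<in> connected_graphs_with_cut_edges n k"
  shows "k < n" and "n - k \<noteq> 2"
    and "distance_spectral_radius G \<ge> distance_spectral_radius (K_pendant n k)"
    and "distance_spectral_radius G = distance_spectral_radius (K_pendant n k) \<Longrightarrow>
      digraph_iso (with_proj G) (with_proj (K_pendant n k))"
proof -
  have G: "connected_graph n G" "card (cut_edges G) = k"
    using assms(2) by (auto simp: connected_graphs_with_cut_edges_def)
  then have V: "pverts G = {0..<n}" and fcg: "fin_conn_graph {0..<n} (parcs G)"
    by (auto simp: connected_graph_iff)
  interpret fin_conn_graph "{0..<n}" "parcs G" by (rule fcg)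
  obtain r where r: "r \<in> {0..<n}" "\<exists>s t. s \<noteq> t \<and> (r, s) \<in> parcs G \<and> (r, t) \<in> parcs G"
    "bridges \<noteq> {} \<Longrightarrow> \<exists>p. (r, p) \<in> bridges"
    using suitable_root assms(1) by auto
  have cf: "card (far r) = k"
    using card_far[OF r(1)] G(2) cut_edges_eq_bridges[of G] fcg by (simp add: V)
  have n3: "n \<ge> 3"
    using assms(1) by simp
  show kn: "k < n" and "n - k \<noteq> 2"
    using far_card_less[OF r(1)] card_near_ne_2[OF r(1)] by (auto simp: cf)
  obtain a b c :: real where abc: "a > 0" "b > 0" "c > 0" "c < a + b" "b < c + a"
    and K: "distance_spectral_radius (K_pendant n k) * (a\<^sup>2 + real (n - k - 1) * b\<^sup>2 + real k * c\<^sup>2) =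
      2 * real k * c * (a + real (n - k - 1) * b + real k * c - c) + 2 * real (n - k - 1) * a * b
      + real (n - k - 1) * (real (n - k - 1) - 1) * b\<^sup>2 + 2 * real (n - k - 1) * real k * b * c"
    by (rule K_pendant_perron[OF kn n3])
  interpret labelled_conn_graph "{0..<n}" "parcs G" r a b c
    using r abc by unfold_locales auto
  let ?N = "a\<^sup>2 + real (n - k - 1) * b\<^sup>2 + real k * c\<^sup>2"
  let ?Q = "\<Sum>s\<in>{0..<n}. \<Sum>t\<in>{0..<n}. graph_dist G s t * label s * label t"
  have km: "local.k = real k" "m = real (n - k - 1)"
    by (simp_all add: k_def m_def cf)
  have "sq_norm_upto n label = ?N"
    using sum_near[of "\<lambda>y. y\<^sup>2"] sum_far[of "\<lambda>y. y\<^sup>2"]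
    unfolding sq_norm_upto_def by (simp add: sum_V_split lessThan_atLeast0 km)
  moreover have "quad_form n (graph_dist G) label = ?Q"
    by (simp add: quad_form_def lessThan_atLeast0)
  moreover have "quad_form n (graph_dist G) label \<le> distance_spectral_radius G * sq_norm_upto n label"
    by (rule distance_matrix_perron[OF G(1) n3])
  ultimately have upper: "?Q \<le> distance_spectral_radius G * ?N"
    by simp
  have dist: "\<exists>l. (s, t) \<in> parcs G ^^ l \<and> graph_dist G s t = real l"
    if "s \<in> {0..<n}" "t \<in> {0..<n}" for s t
    using graph_dist_props(1)[of G s t] that fcg by (simp add: V)
  have lower: "distance_spectral_radius (K_pendant n k) * ?N \<le> ?Q"
    using weighted_distance_sum_ge[of "graph_dist G", OF dist] unfolding K total_eq km by simp
  have "?N > 0"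
    using abc by (simp add: add_pos_nonneg)
  then show "distance_spectral_radius G \<ge> distance_spectral_radius (K_pendant n k)"
    using order.trans[OF lower upper] by simp
  assume "distance_spectral_radius G = distance_spectral_radius (K_pendant n k)"
  then have "?Q = distance_spectral_radius (K_pendant n k) * ?N"
    using lower upper by simp
  then have "parcs G = {(s, t). s \<in> {0..<n} - far r \<and> t \<in> {0..<n} - far r \<and> s \<noteq> t}
      \<union> {r} \<times> far r \<union> far r \<times> {r}"
    using weighted_distance_sum_eqD[of "graph_dist G", OF dist] unfolding K total_eq km by simp
  moreover have "wf_digraph (with_proj G)"
    using E_V by unfold_locales (auto simp: V)
  ultimately show "digraph_iso (with_proj G) (with_proj (K_pendant n k))"
    using digraph_iso_K_pendant[OF V _ r(1) far_subset cf] by blast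
qed

theorem theorem2p2:
  fixes n k :: nat
  assumes "n \<ge> 4"
    and "\<exists>H. H \<in> connected_graphs_with_cut_edges n k"
  shows "K_pendant n k \<in> connected_graphs_with_cut_edges n k \<and>
    (\<forall>G \<in> connected_graphs_with_cut_edges n k.
       distance_spectral_radius G \<ge> distance_spectral_radius (K_pendant n k) \<and>
       (distance_spectral_radius G = distance_spectral_radius (K_pendant n k) \<longrightarrow>
          digraph_iso (with_proj G) (with_proj (K_pendant n k))))"
proof -
  \<comment> \<open>The assumed graph excludes the values of \<open>k\<close> for which
    \<open>K\<^sub>n\<^sup>k\<close> is not defined or has another number of cut edges.\<close>
  have "k < n" "n - k \<noteq> 2"
    using distance_spectral_radius_ge_K_pendant(1,2)[OF assms(1)] assms(2) by blast+
  then have "K_pendant n k \<in> connected_graphs_with_cut_edges n k"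
    using connected_graph_K_pendant card_cut_edges_K_pendant
    by (simp add: connected_graphs_with_cut_edges_def)
  then show ?thesis
    using distance_spectral_radius_ge_K_pendant(3,4)[OF assms(1)] by blast
qed

end
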